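(* Consider the asymmetric log-GARCH$(p,q)$ model with innovations $(\eta_t)$ and associated random matrices $\mathbf{C}=(\boldsymbol{C}_t)_{t\in\mathbb{Z}}$, as defined in the context. Assume that $\gamma(\mathbf{C})<0$ and that $E|\log\eta_0^2|^{s_0}<\infty$ for some $s_0>0$. Let $(\epsilon_t)$, with volatility $(\sigma_t^2)$, be the strictly stationary solution of the model. Then there exists $s>0$ such that $E|\log\epsilon_t^2|^s<\infty$ and $E|\log\sigma_t^2|^s<\infty$.
   Context: **Model.** The asymmetric log-GARCH$(p,q)$ model is, for $t\in\mathbb{Z}$, $$\epsilon_t=\sigma_t\eta_t,\qquad \log\sigma_t^2=\omega+\sum_{i=1}^q\left(\alpha_{i+}1_{\{\epsilon_{t-i}>0\}}+\alpha_{i-}1_{\{\epsilon_{t-i}<0\}}\right)\log\epsilon_{t-i}^2+\sum_{j=1}^p\beta_j\log\sigma_{t-j}^2,$$ where $\sigma_t>0$, the coefficients $\omega,\alpha_{i+},\alpha_{i-},\beta_j$ are real (no sign constraints), and $(\eta_t)_{t\in\mathbb{Z}}$ is a given iid sequence of real random variables with $E\eta_0=0$, $E\eta_0^2=1$. Convention: $\log 0=-\infty$, so that finiteness of a moment of $|\log\eta_0^2|$ entails $P(\eta_0=0)=0$. Write $\boldsymbol{\alpha}_+=(\alpha_{1+},\dots,\alpha_{q+})$, $\boldsymbol{\alpha}_-=(\alpha_{1-},\dots,\alpha_{q-})$, $\boldsymbol{\beta}=(\beta_1,\dots,\beta_p)$ (row vectors). **Matrices.** $\boldsymbol{I}_k$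 is the $k\times k$ identity, $\mathbf{0}$ denotes zero vectors/matrices of the indicated size. $\boldsymbol{C}_t$ is the $(2q+p)\times(2q+p)$ matrix $$\boldsymbol{C}_t=\begin{pmatrix}1_{\{\eta_t>0\}}\boldsymbol{\alpha}_+&1_{\{\eta_t>0\}}\boldsymbol{\alpha}_-&1_{\{\eta_t>0\}}\boldsymbol{\beta}\\ (\boldsymbol{I}_{q-1}\ \mathbf{0}_{q-1})&\mathbf{0}_{(q-1)\times q}&\mathbf{0}_{(q-1)\times p}\\ 1_{\{\eta_t<0\}}\boldsymbol{\alpha}_+&1_{\{\eta_t<0\}}\boldsymbol{\alpha}_-&1_{\{\eta_t<0\}}\boldsymbol{\beta}\\ \mathbf{0}_{(q-1)\times q}&(\boldsymbol{I}_{q-1}\ \mathbf{0}_{q-1})&\mathbf{0}_{(q-1)\times p}\\ \boldsymbol{\alpha}_+&\boldsymbol{\alpha}_-&\boldsymbol{\beta}\\ \mathbf{0}_{(p-1)\times q}&\mathbf{0}_{(p-1)\times q}&(\boldsymbol{I}_{p-1}\ \mathbf{0}_{p-1})\end{pmatrix}$$ (with obvious changes, i.e. empty blocks dropped, when $p\le1$ or $q\le1$). **Top Lyapunov exponent.** $\gamma(\mathbf{C})=\lim_{t\to\infty}\frac1tE\log\|\boldsymbol{C}_t\boldsymbol{C}_{t-1}\cdots\boldsymbol{C}_1\|=\inf_{t\ge1}\frac1tE\log\|\boldsymbol{C}_t\cdots\boldsymbol{C}_1\|$ for any multiplicative (i.e. submultiplicative) matrix norm; the value does not depend on the norm. **Stationary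 solution.** When $\gamma(\mathbf{C})<0$ and $E\log^+|\log\eta_0^2|<\infty$, the model has a unique strictly stationary solution $(\epsilon_t,\sigma_t)_{t\in\mathbb{Z}}$, which is nonanticipative and ergodic; this is the solution referred to. *)

theory Defs
  imports "HOL-Probability.Probability" "Jordan_Normal_Form.Matrix"
begin

(* Logarithm on [0,\<infinity>) with the convention log 0 = -\<infinity>; the library's ln has ln 0 = 0. *)
definition elog :: "real \<Rightarrow> ereal" where
  "elog x = (if x \<le> 0 then -\<infinity> else ereal (ln x))"

(* E |log X|^s in [0,\<infinity>], where |log 0|^s = \<infinity> (used for s > 0 and X \<ge> 0). *)
definition abs_log_moment :: "'a measure \<Rightarrow> real \<Rightarrow> ('a \<Rightarrow> real) \<Rightarrow> ennreal" where
  "abs_log_moment M s X =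
     (\<integral>\<^sup>+ x. (if \<bar>elog (X x)\<bar> = \<infinity> then \<infinity>
            else ennreal (real_of_ereal \<bar>elog (X x)\<bar> powr s)) \<partial>M)"

(* E X = E X^+ - E X^- for extended real X; meaningful unless both parts are infinite.
   e2ennreal sends negative arguments to 0. *)
definition ereal_expectation :: "'a measure \<Rightarrow> ('a \<Rightarrow> ereal) \<Rightarrow> ereal" where
  "ereal_expectation M X =
     enn2ereal (\<integral>\<^sup>+ x. e2ennreal (X x) \<partial>M) - enn2ereal (\<integral>\<^sup>+ x. e2ennreal (- X x) \<partial>M)"

definition iid :: "'a measure \<Rightarrow> (int \<Rightarrow> 'a \<Rightarrow> real) \<Rightarrow> bool" where
  "iid M \<eta> \<longleftrightarrow> prob_space.indep_vars M (\<lambda>_. borel) \<eta> UNIV \<and>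
     (\<forall>t. distr M borel (\<eta> t) = distr M borel (\<eta> 0))"

definition strictly_stationary :: "'a measure \<Rightarrow> 'b measure \<Rightarrow> (int \<Rightarrow> 'a \<Rightarrow> 'b) \<Rightarrow> bool" where
  "strictly_stationary M S X \<longleftrightarrow> (\<forall>t. X t \<in> measurable M S) \<and>
     (\<forall>h. distr M (\<Pi>\<^sub>M t\<in>UNIV. S) (\<lambda>x t. X (t + h) x) = distr M (\<Pi>\<^sub>M t\<in>UNIV. S) (\<lambda>x t. X t x))"

(* The coefficient sequences are indexed from 1: only \<alpha>p i, \<alpha>m i for 1 \<le> i \<le> q and \<beta> j for
   1 \<le> j \<le> p matter. Where \<epsilon> vanishes, both indicators are 0 and the term drops out, in
   agreement with 0 * (-\<infinity>) = 0. *)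
definition log_garch_solution ::
  "'a measure \<Rightarrow> nat \<Rightarrow> nat \<Rightarrow> real \<Rightarrow> (nat \<Rightarrow> real) \<Rightarrow> (nat \<Rightarrow> real) \<Rightarrow> (nat \<Rightarrow> real) \<Rightarrow>
   (int \<Rightarrow> 'a \<Rightarrow> real) \<Rightarrow> (int \<Rightarrow> 'a \<Rightarrow> real) \<Rightarrow> (int \<Rightarrow> 'a \<Rightarrow> real) \<Rightarrow> bool" where
  "log_garch_solution M p q \<omega> \<alpha>p \<alpha>m \<beta> \<eta> \<epsilon> \<sigma> \<longleftrightarrow>
     (\<forall>t. \<epsilon> t \<in> borel_measurable M \<and> \<sigma> t \<in> borel_measurable M) \<and>
     (\<forall>t. AE x in M. 0 < \<sigma> t x \<and> \<epsilon> t x = \<sigma> t x * \<eta> t x \<and>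
        ln ((\<sigma> t x)\<^sup>2) = \<omega>
          + (\<Sum>i=1..q. (\<alpha>p i * of_bool (\<epsilon> (t - int i) x > 0) + \<alpha>m i * of_bool (\<epsilon> (t - int i) x < 0))
                       * ln ((\<epsilon> (t - int i) x)\<^sup>2))
          + (\<Sum>j=1..p. \<beta> j * ln ((\<sigma> (t - int j) x)\<^sup>2)))"

(* The row vector (\<alpha>+, \<alpha>-, \<beta>), with 0-based column index. *)
definition coeff_row ::
  "nat \<Rightarrow> (nat \<Rightarrow> real) \<Rightarrow> (nat \<Rightarrow> real) \<Rightarrow> (nat \<Rightarrow> real) \<Rightarrow> nat \<Rightarrow> real" where
  "coeff_row q \<alpha>p \<alpha>m \<beta> j =
     (if j < q then \<alpha>p (j + 1) else if j < 2 * q then \<alpha>m (j - q + 1) else \<beta> (j - 2 * q + 1))"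

(* C_t as a function of the value e of \<eta>_t. The rows 0, q and 2q are the full rows heading the
   three block rows; every (I 0) block consists of 1s in column i - 1 of row i.
   For q = 0 or p = 0 the corresponding blocks are empty. *)
definition garch_matrix ::
  "nat \<Rightarrow> nat \<Rightarrow> (nat \<Rightarrow> real) \<Rightarrow> (nat \<Rightarrow> real) \<Rightarrow> (nat \<Rightarrow> real) \<Rightarrow> real \<Rightarrow> real mat" where
  "garch_matrix p q \<alpha>p \<alpha>m \<beta> e = mat (2 * q + p) (2 * q + p) (\<lambda>(i, j).
     if 0 < q \<and> i = 0 then of_bool (e > 0) * coeff_row q \<alpha>p \<alpha>m \<beta> j
     else if 0 < q \<and> i = q then of_bool (e < 0) * coeff_row q \<alpha>p \<alpha>m \<beta> j
     else if i = 2 * q then coeff_row q \<alpha>p \<alpha>m \<beta> j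
     else of_bool (i = j + 1))"

definition multiplicative_norm :: "nat \<Rightarrow> (real mat \<Rightarrow> real) \<Rightarrow> bool" where
  "multiplicative_norm n N \<longleftrightarrow>
     (\<forall>A \<in> carrier_mat n n. 0 \<le> N A \<and> (N A = 0 \<longleftrightarrow> A = 0\<^sub>m n n)) \<and>
     (\<forall>A \<in> carrier_mat n n. \<forall>c. N (c \<cdot>\<^sub>m A) = \<bar>c\<bar> * N A) \<and>
     (\<forall>A \<in> carrier_mat n n. \<forall>B \<in> carrier_mat n n. N (A + B) \<le> N A + N B) \<and>
     (\<forall>A \<in> carrier_mat n n. \<forall>B \<in> carrier_mat n n. N (A * B) \<le> N A * N B)"

(* C_t C_(t-1) ... C_1 *)
primrec left_product :: "nat \<Rightarrow> (int \<Rightarrow> real mat) \<Rightarrow> nat \<Rightarrow> real mat" where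
  "left_product n C 0 = 1\<^sub>m n"
| "left_product n C (Suc t) = C (int (Suc t)) * left_product n C t"

(* inf over t \<ge> 1 of E log ||C_t ... C_1|| / t; by subadditivity this is also the limit as t \<rightarrow> \<infinity>
   (for stationary independent C). The products may vanish with positive probability, so the
   exponent is extended-real valued. *)
definition top_lyapunov ::
  "'a measure \<Rightarrow> nat \<Rightarrow> (real mat \<Rightarrow> real) \<Rightarrow> (int \<Rightarrow> 'a \<Rightarrow> real mat) \<Rightarrow> ereal" where
  "top_lyapunov M n N C =
     (INF t\<in>{1::nat..}. ereal_expectation M (\<lambda>x. elog (N (left_product n (\<lambda>k. C k x) t))) / ereal (real t))"

end

theory Submission
  imports Defs
begin

text \<open>
  The logarithms satisfy an affine recursion \<open>z\<^sub>t = C\<^sub>t z\<^sub>t\<^sub>-\<^sub>1 + b\<^sub>t\<close>.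
  As the exponent is an infimum, a negative value gives a block length \<open>k\<close> with
  \<open>E log \<parallel>C\<^sub>k \<dots> C\<^sub>1\<parallel> < 0\<close>, hence, \<open>C\<^sub>t\<close> being bounded,
  \<open>E \<parallel>C\<^sub>k \<dots> C\<^sub>1\<parallel>\<^sup>s < 1\<close> for small \<open>s\<close>. Unfolding the recursion
  backwards in blocks of length \<open>k\<close> bounds \<open>\<parallel>z\<^sub>t\<parallel>\<^sup>s\<close> by a series whose expectations decay
  geometrically, plus a remainder that tends to 0 in probability by stationarity.
\<close>

section \<open>Moments of small order\<close>

text \<open>One exponent \<open>s\<close> has to meet three demands: it is small enough for the
  block contraction, at most 1 so that \<open>x powr s\<close> is subadditive and sums can be split
  without Hoelder or Minkowski, and at most \<open>s0\<close> so that the innovations have the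
  moment. Two obstacles shape the rest. The solution enters only through its recursion and its
  stationarity, so the state at the start of a block is not known to be independent of the
  innovations inside the block. And the norm \<open>N\<close> is arbitrary, with no measurability
  attached to it. The state is therefore measured by the sum of absolute values of its entries,
  which is measurable and inherits stationarity, and is compared with \<open>N\<close> by
  equivalence of norms. Matrix products cause no such trouble: the matrix depends on the innovation
  only through its sign, so a product over a block takes finitely many values.\<close>

lemma powr_add_le_add_powr:
  fixes x y s :: real
  assumes "0 \<le> x" "0 \<le> y" "0 < s" "s \<le> 1"
  shows "(x + y) powr s \<le> x powr s + y powr s"
proof (cases "x + y = 0")
  case True
  then show ?thesis using assms by simp
next
  case False
  with assms have pos: "x + y > 0" by simp
  \<comment> \<open>Dividing by \<open>x + y\<close> puts both terms into [0,1], where a power of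
    order at most 1 can only enlarge.\<close>
  have le: "r \<le> r powr s" if "0 \<le> r" "r \<le> 1" for r :: real
    using powr_mono'[of s 1 r] that assms by (cases "r = 0") auto
  have "1 = x / (x + y) + y / (x + y)" using pos by (simp flip: add_divide_distrib)
  also have "\<dots> \<le> (x / (x + y)) powr s + (y / (x + y)) powr s"
    using pos assms by (intro add_mono le) auto
  also have "\<dots> = (x powr s + y powr s) / (x + y) powr s"
    using pos assms by (simp add: powr_divide add_divide_distrib)
  finally show ?thesis using pos by (simp add: field_simps)
qed

lemma powr_sum_le_sum_powr:
  fixes f :: "'i \<Rightarrow> real" and s :: real
  assumes "finite A" "\<And>i. i \<in> A \<Longrightarrow> 0 \<le> f i" "0 < s" "s \<le> 1"
  shows "(\<Sum>i\<in>A. f i) powr s \<le> (\<Sum>i\<in>A. f i powr s)"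
  using assms(1,2)
proof (induction A rule: finite_induct)
  case (insert a A)
  have "(f a + sum f A) powr s \<le> f a powr s + sum f A powr s"
    using insert assms by (intro powr_add_le_add_powr sum_nonneg) auto
  with insert show ?case by fastforce
qed simp

lemma exp_le_quadratic:
  fixes y :: real
  assumes "\<bar>y\<bar> \<le> 1"
  shows "exp y \<le> 1 + y + y\<^sup>2"
proof (cases "0 \<le> y")
  case True
  then show ?thesis using exp_bound assms by simp
next
  case False
  \<comment> \<open>The product telescopes to 1 - y^3, which exceeds 1 for negative
    \<open>y\<close>.\<close>
  have "1 \<le> (1 + y + y\<^sup>2) * (1 - y)"
    using False by (simp add: algebra_simps power2_eq_square mult_nonneg_nonpos2 mult_nonneg_nonpos)
  also have "\<dots> \<le> (1 + y + y\<^sup>2) * exp (- y)"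
    using assms exp_ge_add_one_self[of "-y"] by (intro mult_left_mono) auto
  finally show ?thesis by (simp add: exp_minus field_simps)
qed

text \<open>The elementary half of \<open>d/ds E X\<^sup>s = E log X\<close> at \<open>s = 0\<close>; truncating
  \<open>log X\<close> from below makes it bounded while keeping its mean negative.\<close>

lemma ex_small_moment_less_one:
  assumes "prob_space M" and X[measurable]: "X \<in> borel_measurable M"
    and X0: "\<And>x. 0 \<le> X x" and XL: "\<And>x. X x \<le> L"
    and neg: "ereal_expectation M (\<lambda>x. elog (X x)) < 0" and s1: "0 < s1"
  shows "\<exists>s>0. s \<le> s1 \<and> (\<integral>\<^sup>+x. ennreal (X x powr s) \<partial>M) < 1"
proof -
  interpret prob_space M by fact
  \<comment> \<open>A bound of at least 1 has a nonnegative logarithm, which then bounds the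
    positive part \<open>f\<close> of log X.\<close>
  define L' where "L' = max L 1"
  have L': "1 \<le> L'" "\<And>x. X x \<le> L'" using XL by (auto simp: L'_def le_max_iff_disj)
  define f where "f x = e2ennreal (elog (X x))" for x
  define g where "g x = e2ennreal (- elog (X x))" for x
  have f_eq: "f x = (if X x \<le> 0 then 0 else ennreal (ln (X x)))" for x
    by (auto simp: f_def elog_def e2ennreal_neg)
  have g_eq: "g x = (if X x \<le> 0 then \<infinity> else ennreal (- ln (X x)))" for x
    by (auto simp: g_def elog_def e2ennreal_neg)
  have [measurable]: "f \<in> borel_measurable M" "g \<in> borel_measurable M"
    unfolding f_eq[abs_def] g_eq[abs_def] by measurable
  have "(\<integral>\<^sup>+x. f x \<partial>M) \<le> (\<integral>\<^sup>+x. ennreal (ln L') \<partial>M)"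
    using L' by (intro nn_integral_mono) (auto simp: f_eq intro!: ennreal_leI)
  then have f_fin: "(\<integral>\<^sup>+x. f x \<partial>M) < \<infinity>"
    by (simp add: emeasure_space_1 order_le_less_trans)
  \<comment> \<open>Finiteness of the first integral makes the difference meaningful. The integral
    of \<open>g\<close> may be infinite, for instance if \<open>X\<close> vanishes with positive
    probability.\<close>
  have "enn2ereal (\<integral>\<^sup>+x. f x \<partial>M) < enn2ereal (\<integral>\<^sup>+x. g x \<partial>M)"
    using neg f_fin unfolding ereal_expectation_def f_def[symmetric] g_def[symmetric]
    by (cases "\<integral>\<^sup>+x. f x \<partial>M"; cases "\<integral>\<^sup>+x. g x \<partial>M") (auto simp: enn2ereal_ennreal)
  then have fg: "(\<integral>\<^sup>+x. f x \<partial>M) < (\<integral>\<^sup>+x. g x \<partial>M)"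
    by (simp add: less_ennreal.rep_eq)
  have "g x = (SUP m. min (g x) (of_nat m))" for x
  proof (cases "g x = \<infinity>")
    case True
    then show ?thesis by (simp add: min_absorb2 ennreal_SUP_of_nat_eq_top)
  next
    case False
    then obtain r where r: "g x = ennreal r" "0 \<le> r" by (cases "g x") auto
    obtain m :: nat where "r \<le> real m" using real_arch_simple by blast
    then have "g x \<le> of_nat m" using r by (simp add: ennreal_of_nat_eq_real_of_nat ennreal_leI)
    then show ?thesis
      by (intro antisym SUP_least) (auto intro!: SUP_upper2[of m])
  qed
  then have "(\<integral>\<^sup>+x. g x \<partial>M) = (\<integral>\<^sup>+x. (SUP m. min (g x) (of_nat m)) \<partial>M)" by simp
  also have "\<dots> = (SUP m. \<integral>\<^sup>+x. min (g x) (of_nat m) \<partial>M)"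
    by (intro nn_integral_monotone_convergence_SUP)
       (auto simp: incseq_def le_fun_def intro: min.coboundedI2 of_nat_mono)
  finally obtain m :: nat where m: "(\<integral>\<^sup>+x. f x \<partial>M) < (\<integral>\<^sup>+x. min (g x) (of_nat m) \<partial>M)"
    using fg by (auto simp: less_SUP_iff)
  \<comment> \<open>The cut is made inside the logarithm, so \<open>ln 0\<close> never occurs:
    \<open>Y\<close> is log X cut off at -m. Its positive and negative parts are \<open>f\<close>
    and \<open>min (g x) m\<close>.\<close>
  define Y where "Y x = ln (max (X x) (exp (- real m)))" for x
  have [measurable]: "Y \<in> borel_measurable M" unfolding Y_def[abs_def] by measurable
  define B where "B = ln L' + real m + 1"
  have B: "1 \<le> B" using L' by (simp add: B_def)
  have Y_ge: "- real m \<le> Y x" for x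
    unfolding Y_def by (subst ln_ge_iff) (auto simp: less_max_iff_disj)
  have Y_le: "Y x \<le> ln L'" for x
  proof -
    have "max (X x) (exp (- real m)) \<le> L'" using L' by (auto intro: order_trans[of _ 1])
    then show ?thesis unfolding Y_def using L' by (subst ln_le_cancel_iff) (auto simp: less_max_iff_disj)
  qed
  have YB: "\<bar>Y x\<bar> \<le> B" for x
    using Y_ge[of x] Y_le[of x] ln_ge_zero[OF L'(1)] unfolding B_def by linarith
  have intY: "integrable M Y"
    by (rule integrable_const_bound[of _ B]) (use YB in auto)
  have Yp: "ennreal (Y x) = f x" for x
  proof (cases "X x \<le> exp (- real m)")
    case True
    then have "X x \<le> 1" by (rule order_trans) simp
    with True show ?thesis by (auto simp: Y_def f_eq max_absorb2 ennreal_neg ln_le_zero_iff)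
  next
    case False
    moreover have "0 < X x" using False exp_gt_zero[of "- real m"] by linarith
    ultimately show ?thesis by (auto simp: Y_def f_eq max_absorb1)
  qed
  have Yn: "ennreal (- Y x) = min (g x) (of_nat m)" for x
  proof (cases "X x \<le> exp (- real m)")
    case True
    have "ennreal m \<le> g x"
    proof (cases "X x \<le> 0")
      case False
      then have "ln (X x) \<le> - real m" using True ln_le_cancel_iff[of "X x" "exp (- real m)"] by simp
      then show ?thesis using False by (auto simp: g_eq intro!: ennreal_leI)
    qed (simp add: g_eq)
    with True show ?thesis by (auto simp: Y_def max_absorb2 min_absorb2 ennreal_of_nat_eq_real_of_nat)
  next
    case False
    then have X: "0 < X x" "- real m < ln (X x)"
      using exp_gt_zero[of "- real m"] ln_less_cancel_iff[of "exp (- real m)" "X x"]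
      by (auto simp del: exp_gt_zero intro: less_trans)
    then have "g x \<le> ennreal m" by (auto simp: g_eq intro!: ennreal_leI)
    with X False show ?thesis
      by (auto simp: Y_def g_eq max_absorb1 min_absorb1 ennreal_of_nat_eq_real_of_nat)
  qed
  define e where "e = (\<integral>x. Y x \<partial>M)"
  have "e = enn2real (\<integral>\<^sup>+x. f x \<partial>M) - enn2real (\<integral>\<^sup>+x. min (g x) (of_nat m) \<partial>M)"
    using real_lebesgue_integral_def[OF intY] by (simp add: e_def Yp Yn)
  moreover have "(\<integral>\<^sup>+x. min (g x) (of_nat m) \<partial>M) \<le> (\<integral>\<^sup>+x. of_nat m \<partial>M)"
    by (intro nn_integral_mono) auto
  then have "(\<integral>\<^sup>+x. min (g x) (of_nat m) \<partial>M) < \<infinity>"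
    by (simp add: emeasure_space_1 order_le_less_trans ennreal_of_nat_eq_real_of_nat)
  then have "enn2real (\<integral>\<^sup>+x. f x \<partial>M) < enn2real (\<integral>\<^sup>+x. min (g x) (of_nat m) \<partial>M)"
    using m by (subst enn2real_less_iff) (auto simp: less_top)
  ultimately have e: "e < 0" by simp
  \<comment> \<open>The bound 1/B keeps \<open>s * Y x\<close> within [-1,1], where the quadratic
    estimate of exp holds. The bound -e/(2B^2) makes the quadratic term at most half of the gain
    -s*e.\<close>
  define s where "s = min s1 (min (1 / B) (- e / (2 * B\<^sup>2)))"
  have s: "0 < s" "s \<le> s1" "s \<le> 1 / B" "s \<le> - e / (2 * B\<^sup>2)"
    using s1 B e by (auto simp: s_def intro!: divide_neg_pos)
  have "(\<integral>\<^sup>+x. ennreal (X x powr s) \<partial>M) \<le> (\<integral>\<^sup>+x. ennreal (1 + s * Y x + s\<^sup>2 * B\<^sup>2) \<partial>M)"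
  proof (intro nn_integral_mono ennreal_leI)
    fix x
    have "X x powr s \<le> max (X x) (exp (- real m)) powr s"
      using X0 s by (intro powr_mono2) auto
    also have "\<dots> = exp (s * Y x)" using X0[of x] exp_gt_zero[of "- real m"]
      by (auto simp: powr_def Y_def max_def simp del: exp_gt_zero)
    also have "\<dots> \<le> 1 + s * Y x + (s * Y x)\<^sup>2"
    proof (rule exp_le_quadratic)
      have "\<bar>s * Y x\<bar> \<le> 1 / B * B" unfolding abs_mult
        using s YB[of x] B by (intro mult_mono) auto
      then show "\<bar>s * Y x\<bar> \<le> 1" using B by simp
    qed
    also have "(s * Y x)\<^sup>2 \<le> s\<^sup>2 * B\<^sup>2"
      using YB[of x] B by (auto simp: power_mult_distrib abs_le_square_iff[symmetric] intro!: mult_left_mono)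
    finally show "X x powr s \<le> 1 + s * Y x + s\<^sup>2 * B\<^sup>2" by simp
  qed
  also have "\<dots> = ennreal (\<integral>x. 1 + s * Y x + s\<^sup>2 * B\<^sup>2 \<partial>M)"
  proof (rule nn_integral_eq_integral)
    show "AE x in M. 0 \<le> 1 + s * Y x + s\<^sup>2 * B\<^sup>2"
    proof (rule AE_I2)
      fix x
      have "\<bar>s * Y x\<bar> \<le> 1 / B * B" unfolding abs_mult
        using s YB[of x] B by (intro mult_mono) auto
      then have "0 \<le> 1 + s * Y x" using B by simp
      moreover have "0 \<le> s\<^sup>2 * B\<^sup>2" by simp
      ultimately show "0 \<le> 1 + s * Y x + s\<^sup>2 * B\<^sup>2" by linarith
    qed
  qed (use intY in auto)
  also have "(\<integral>x. 1 + s * Y x + s\<^sup>2 * B\<^sup>2 \<partial>M) = 1 + s * e + s\<^sup>2 * B\<^sup>2"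
    using intY by (simp add: e_def prob_space)
  also have "ennreal \<dots> < 1"
  proof -
    have "s\<^sup>2 * B\<^sup>2 = s * (s * B\<^sup>2)" by (simp add: power2_eq_square)
    also have "\<dots> \<le> s * ((- e / (2 * B\<^sup>2)) * B\<^sup>2)"
      using s by (intro mult_left_mono mult_right_mono) auto
    also have "\<dots> = - s * e / 2" using B by simp
    finally have "1 + s * e + s\<^sup>2 * B\<^sup>2 \<le> 1 + s * e / 2" by (simp add: field_simps)
    also have "\<dots> < 1" using s e by (simp add: mult_pos_neg)
    finally show ?thesis using ennreal_less_one_iff by auto
  qed
  finally show ?thesis using s by blast
qed

section \<open>Affine recursions with identically distributed solution\<close>

text \<open>Monotone convergence. It is needed because the bound for the state can first be proved
  only for truncated moments, uniformly in the truncation level.\<close>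

lemma nn_integral_le_of_truncations:
  fixes f :: "'a \<Rightarrow> real"
  assumes [measurable]: "f \<in> borel_measurable M"
    and "\<And>K::nat. (\<integral>\<^sup>+x. ennreal (min (f x) (real K)) \<partial>M) \<le> T"
  shows "(\<integral>\<^sup>+x. ennreal (f x) \<partial>M) \<le> T"
proof -
  have "ennreal (f x) = (SUP K::nat. ennreal (min (f x) (real K)))" for x
  proof -
    obtain K :: nat where "f x \<le> real K" using real_arch_simple by blast
    then have "ennreal (f x) \<le> ennreal (min (f x) (real K))" by simp
    then show ?thesis
      by (intro antisym SUP_least) (auto intro!: SUP_upper2[of K] ennreal_leI)
  qed
  then have "(\<integral>\<^sup>+x. ennreal (f x) \<partial>M) = (\<integral>\<^sup>+x. (SUP K::nat. ennreal (min (f x) (real K))) \<partial>M)"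
    by simp
  also have "\<dots> = (SUP K::nat. \<integral>\<^sup>+x. ennreal (min (f x) (real K)) \<partial>M)"
    by (intro nn_integral_monotone_convergence_SUP)
       (auto simp: incseq_def le_fun_def intro!: ennreal_leI)
  also have "\<dots> \<le> T" using assms(2) by (intro SUP_least) auto
  finally show ?thesis .
qed

text \<open>Tightness of a single law. For identically distributed variables it serves all of them
  at once.\<close>

lemma (in prob_space) tail_tendsto_0:
  fixes X :: "'a \<Rightarrow> real"
  assumes [measurable]: "X \<in> borel_measurable M"
  shows "(\<lambda>n::nat. prob {x \<in> space M. real n < X x}) \<longlonglongrightarrow> 0"
proof -
  have "(\<Inter>n::nat. {x \<in> space M. real n < X x}) = {}"
  proof (intro equals0I)
    fix x assume *: "x \<in> (\<Inter>n::nat. {x \<in> space M. real n < X x})"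
    obtain n :: nat where "X x < real n" using reals_Archimedean2 by blast
    moreover from * have "real n < X x" by blast
    ultimately show False by simp
  qed
  moreover have "(\<lambda>n::nat. prob {x \<in> space M. real n < X x}) \<longlonglongrightarrow> prob (\<Inter>n::nat. {x \<in> space M. real n < X x})"
    by (intro finite_Lim_measure_decseq) (auto simp: decseq_def)
  ultimately show ?thesis by simp
qed

text \<open>The index counts steps into the past, so \<open>w 0\<close> is the present value and
  \<open>w n\<close> the remainder.\<close>

lemma affine_recursion_unfold:
  fixes w a c :: "nat \<Rightarrow> real"
  assumes "\<And>m. w m \<le> a m * w (Suc m) + c m" "\<And>m. 0 \<le> a m"
  shows "w 0 \<le> (\<Prod>i<n. a i) * w n + (\<Sum>j<n. (\<Prod>i<j. a i) * c j)"
proof (induction n)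
  case (Suc n)
  have "(\<Prod>i<n. a i) * w n \<le> (\<Prod>i<n. a i) * (a n * w (Suc n) + c n)"
    using assms by (intro mult_left_mono prod_nonneg) auto
  with Suc show ?case by (simp add: algebra_simps)
qed simp

text \<open>The remainder of the unfolded recursion is a product of dependent factors, so its moments
  are out of reach. But the \<open>V n\<close> have a common law and are therefore tight, so the remainder
  drops out of the moment of \<open>V 0\<close> truncated at \<open>K\<close>.\<close>

lemma (in prob_space) affine_recursion_moment_finite:
  fixes V W a c :: "nat \<Rightarrow> 'a \<Rightarrow> real"
  assumes s: "0 < s" "s \<le> 1"
    and V[measurable]: "\<And>m. V m \<in> borel_measurable M"
    and a[measurable]: "\<And>m. a m \<in> borel_measurable M"
    and c[measurable]: "\<And>m. c m \<in> borel_measurable M"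
    and V0: "\<And>m x. 0 \<le> V m x" and a0: "\<And>m x. 0 \<le> a m x" and c0: "\<And>m x. 0 \<le> c m x"
    and dist: "\<And>m. distr M borel (V m) = distr M borel (V 0)"
    and rec: "AE x in M. \<forall>m. W m x \<le> a m x * W (Suc m) x + c m x"
    and VW: "\<And>m x. V m x \<le> \<kappa> * W m x" and WV: "\<And>m x. W m x \<le> \<kappa> * V m x" and \<kappa>: "0 \<le> \<kappa>"
    and prod_a: "\<And>n. (\<integral>\<^sup>+x. ennreal ((\<Prod>i<n. a i x) powr s) \<partial>M) \<le> ennreal (\<rho> ^ n)"
    and prod_c: "\<And>n. (\<integral>\<^sup>+x. ennreal (((\<Prod>i<n. a i x) * c n x) powr s) \<partial>M) \<le> ennreal (\<rho> ^ n * b)"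
    and \<rho>: "0 \<le> \<rho>" "\<rho> < 1" and b: "0 \<le> b"
  shows "(\<integral>\<^sup>+x. ennreal (V 0 x powr s) \<partial>M) < \<infinity>"
proof -
  define P where "P n x = (\<Prod>i<n. a i x)" for n x
  have P0: "0 \<le> P n x" for n x unfolding P_def using a0 by (intro prod_nonneg) auto
  have [measurable]: "P n \<in> borel_measurable M" for n unfolding P_def[abs_def] by measurable
  \<comment> \<open>The moment bound of the whole backward series: the geometric series of the
    \<rho>^j * b, with a factor for the passage from \<open>W\<close> to \<open>V\<close>.\<close>
  define T where "T = \<kappa> powr s * (b / (1 - \<rho>))"
  have T0: "0 \<le> T" using b \<rho> by (simp add: T_def)
  \<comment> \<open>\<open>K\<close> is the truncation level, \<open>R\<close> a threshold for the
    remainder, \<open>n\<close> the depth of unfolding. Where \<open>V n\<close> exceeds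
    \<open>R\<close> the truncated moment is at most \<open>K\<close>; elsewhere \<open>V n\<close>
    is replaced by \<open>R\<close>, and only the product \<open>P n\<close> with its geometric
    moment is left.\<close>
  have bound: "(\<integral>\<^sup>+x. ennreal (min (V 0 x powr s) (real K)) \<partial>M)
      \<le> ennreal (real K * prob {x \<in> space M. real R < V 0 x} + (\<kappa>\<^sup>2 * real R) powr s * \<rho> ^ n + T)"
    for K R n :: nat
  proof -
    have sumc: "(\<Sum>j<n. \<rho> ^ j * b) \<le> b / (1 - \<rho>)"
    proof -
      have "(\<Sum>j<n. \<rho> ^ j) \<le> (\<Sum>j. \<rho> ^ j)"
        using \<rho> by (intro sum_le_suminf) (auto intro: summable_geometric)
      then have "(\<Sum>j<n. \<rho> ^ j) \<le> 1 / (1 - \<rho>)" using \<rho> by (simp add: suminf_geometric)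
      from mult_right_mono[OF this b] show ?thesis by (simp add: sum_distrib_right)
    qed
    have "AE x in M. ennreal (min (V 0 x powr s) (real K)) \<le>
        ennreal (real K) * indicator {x \<in> space M. real R < V n x} x
        + ennreal ((\<kappa>\<^sup>2 * real R) powr s) * ennreal (P n x powr s)
        + ennreal (\<kappa> powr s) * (\<Sum>j<n. ennreal ((P j x * c j x) powr s))"
      using rec AE_space
    proof eventually_elim
      case (elim x)
      let ?S = "\<Sum>j<n. P j x * c j x"
      have S0: "0 \<le> ?S" using P0 c0 by (intro sum_nonneg) auto
      \<comment> \<open>The recursion is given for \<open>W\<close>, measurability and the common
        law for \<open>V\<close>. Passing to \<open>W\<close> at index 0 and back at index
        \<open>n\<close> costs one factor \<kappa> each, hence the square in front of the
        remainder.\<close>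
      have "V 0 x \<le> \<kappa> * W 0 x" by (rule VW)
      also have "\<dots> \<le> \<kappa> * (P n x * W n x + ?S)"
        unfolding P_def using elim(1) a0 \<kappa>
        by (intro mult_left_mono affine_recursion_unfold[of "\<lambda>n. W n x"]) auto
      also have "\<dots> \<le> \<kappa> * (P n x * (\<kappa> * V n x) + ?S)"
        using WV P0 \<kappa> by (intro mult_left_mono add_mono) auto
      finally have V_le: "V 0 x \<le> \<kappa>\<^sup>2 * V n x * P n x + \<kappa> * ?S"
        by (simp add: algebra_simps power2_eq_square)
      show ?case
      proof (cases "real R < V n x")
        case True
        then have "ennreal (min (V 0 x powr s) (real K)) \<le> ennreal (real K) * indicator {x \<in> space M. real R < V n x} x"
          using elim by (auto intro!: ennreal_leI)
        then show ?thesis by (simp add: add_increasing2)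
      next
        case False
        have "V 0 x powr s \<le> (\<kappa>\<^sup>2 * V n x * P n x + \<kappa> * ?S) powr s"
          using V_le V0 s by (intro powr_mono2) auto
        also have "\<dots> \<le> (\<kappa>\<^sup>2 * V n x * P n x) powr s + (\<kappa> * ?S) powr s"
          using V0 P0 S0 \<kappa> s by (intro powr_add_le_add_powr) auto
        also have "(\<kappa>\<^sup>2 * V n x * P n x) powr s \<le> (\<kappa>\<^sup>2 * real R * P n x) powr s"
          using False V0 P0 s by (intro powr_mono2 mult_right_mono mult_left_mono) auto
        also have "\<dots> = (\<kappa>\<^sup>2 * real R) powr s * P n x powr s"
          by (rule powr_mult)
        also have "(\<kappa> * ?S) powr s = \<kappa> powr s * ?S powr s"
          by (rule powr_mult)
        also have "?S powr s \<le> (\<Sum>j<n. (P j x * c j x) powr s)"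
          using P0 c0 s by (intro powr_sum_le_sum_powr) auto
        finally have "V 0 x powr s \<le> (\<kappa>\<^sup>2 * real R) powr s * P n x powr s
            + \<kappa> powr s * (\<Sum>j<n. (P j x * c j x) powr s)"
          by (simp add: mult_left_mono)
        then have "ennreal (min (V 0 x powr s) (real K)) \<le> ennreal ((\<kappa>\<^sup>2 * real R) powr s * P n x powr s
            + \<kappa> powr s * (\<Sum>j<n. (P j x * c j x) powr s))"
          by (intro ennreal_leI) auto
        also have "\<dots> = ennreal ((\<kappa>\<^sup>2 * real R) powr s) * ennreal (P n x powr s)
            + ennreal (\<kappa> powr s) * (\<Sum>j<n. ennreal ((P j x * c j x) powr s))"
          by (simp add: ennreal_plus ennreal_mult sum_nonneg sum_ennreal)
        finally show ?thesis using False by simp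
      qed
    qed
    then have "(\<integral>\<^sup>+x. ennreal (min (V 0 x powr s) (real K)) \<partial>M) \<le>
        (\<integral>\<^sup>+x. ennreal (real K) * indicator {x \<in> space M. real R < V n x} x
        + ennreal ((\<kappa>\<^sup>2 * real R) powr s) * ennreal (P n x powr s)
        + ennreal (\<kappa> powr s) * (\<Sum>j<n. ennreal ((P j x * c j x) powr s)) \<partial>M)"
      by (rule nn_integral_mono_AE)
    also have "\<dots> = ennreal (real K) * emeasure M {x \<in> space M. real R < V n x}
        + ennreal ((\<kappa>\<^sup>2 * real R) powr s) * (\<integral>\<^sup>+x. ennreal (P n x powr s) \<partial>M)
        + ennreal (\<kappa> powr s) * (\<Sum>j<n. \<integral>\<^sup>+x. ennreal ((P j x * c j x) powr s) \<partial>M)"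
      by (simp add: nn_integral_add nn_integral_cmult nn_integral_sum nn_integral_cmult_indicator del: sum_ennreal)
    also have "\<dots> \<le> ennreal (real K) * ennreal (prob {x \<in> space M. real R < V 0 x})
        + ennreal ((\<kappa>\<^sup>2 * real R) powr s) * ennreal (\<rho> ^ n)
        + ennreal (\<kappa> powr s) * (\<Sum>j<n. ennreal (\<rho> ^ j * b))"
    proof (intro add_mono mult_left_mono sum_mono)
      \<comment> \<open>The common law turns the tail of \<open>V n\<close> into that of
        \<open>V 0\<close>, which no longer depends on \<open>n\<close>.\<close>
      have "prob {x \<in> space M. real R < V n x} = measure (distr M borel (V n)) {real R<..}"
        by (subst measure_distr) (auto intro!: arg_cong[of _ _ prob])
      also have "\<dots> = prob {x \<in> space M. real R < V 0 x}"
        unfolding dist[of n] by (subst measure_distr) (auto intro!: arg_cong[of _ _ prob])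
      finally show "emeasure M {x \<in> space M. real R < V n x} \<le> ennreal (prob {x \<in> space M. real R < V 0 x})"
        by (simp add: emeasure_eq_measure)
    qed (use prod_a prod_c in \<open>auto simp: P_def\<close>)
    also have "\<dots> = ennreal (real K * prob {x \<in> space M. real R < V 0 x}
        + (\<kappa>\<^sup>2 * real R) powr s * \<rho> ^ n + \<kappa> powr s * (\<Sum>j<n. \<rho> ^ j * b))"
      using \<rho> b by (simp add: sum_nonneg flip: ennreal_plus ennreal_mult)
    also have "\<dots> \<le> ennreal (real K * prob {x \<in> space M. real R < V 0 x} + (\<kappa>\<^sup>2 * real R) powr s * \<rho> ^ n + T)"
      unfolding T_def by (intro ennreal_leI add_left_mono mult_left_mono sumc) auto
    finally show ?thesis .
  qed
  have "(\<integral>\<^sup>+x. ennreal (min (V 0 x powr s) (real K)) \<partial>M) \<le> ennreal T" for K :: nat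
  proof -
    \<comment> \<open>The order of the limits matters: \<open>n\<close> grows first, with
      \<open>R\<close> and \<open>K\<close> fixed, and removes the geometric term; then
      \<open>R\<close> grows and removes the tail probability. The limit \<open>T\<close> is free of
      \<open>K\<close>, which is released last.\<close>
    have le: "(\<integral>\<^sup>+x. ennreal (min (V 0 x powr s) (real K)) \<partial>M)
        \<le> ennreal (real K * prob {x \<in> space M. real R < V 0 x} + (\<kappa>\<^sup>2 * real R) powr s * 0 + T)" for R :: nat
    proof (rule tendsto_lowerbound)
      show "(\<lambda>n. ennreal (real K * prob {x \<in> space M. real R < V 0 x} + (\<kappa>\<^sup>2 * real R) powr s * \<rho> ^ n + T))
          \<longlonglongrightarrow> ennreal (real K * prob {x \<in> space M. real R < V 0 x} + (\<kappa>\<^sup>2 * real R) powr s * 0 + T)"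
        using \<rho> by (intro tendsto_ennrealI tendsto_intros LIMSEQ_realpow_zero) auto
    qed (use bound in auto)
    have lim: "(\<lambda>R. ennreal (real K * prob {x \<in> space M. real R < V 0 x} + (\<kappa>\<^sup>2 * real R) powr s * 0 + T))
        \<longlonglongrightarrow> ennreal (real K * 0 + 0 + T)"
      unfolding mult_zero_right[of "_ powr s"]
      by (intro tendsto_ennrealI tendsto_intros tail_tendsto_0) auto
    have "(\<integral>\<^sup>+x. ennreal (min (V 0 x powr s) (real K)) \<partial>M) \<le> ennreal (real K * 0 + 0 + T)"
      by (rule LIMSEQ_le_const[OF lim]) (use le in blast)
    then show ?thesis by simp
  qed
  moreover have "(\<lambda>x. V 0 x powr s) \<in> borel_measurable M" by measurable
  ultimately have "(\<integral>\<^sup>+x. ennreal (V 0 x powr s) \<partial>M) \<le> ennreal T"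
    by (rule nn_integral_le_of_truncations[rotated])
  then show ?thesis by (rule order_le_less_trans) simp
qed

section \<open>Multiplicative matrix norms\<close>

lemma
  assumes "multiplicative_norm n N"
  shows multiplicative_norm_nonneg: "A \<in> carrier_mat n n \<Longrightarrow> 0 \<le> N A"
    and multiplicative_norm_eq_0_iff: "A \<in> carrier_mat n n \<Longrightarrow> N A = 0 \<longleftrightarrow> A = 0\<^sub>m n n"
    and multiplicative_norm_zero: "N (0\<^sub>m n n) = 0"
    and multiplicative_norm_smult: "A \<in> carrier_mat n n \<Longrightarrow> N (c \<cdot>\<^sub>m A) = \<bar>c\<bar> * N A"
    and multiplicative_norm_add:
      "A \<in> carrier_mat n n \<Longrightarrow> B \<in> carrier_mat n n \<Longrightarrow> N (A + B) \<le> N A + N B"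
    and multiplicative_norm_mult:
      "A \<in> carrier_mat n n \<Longrightarrow> B \<in> carrier_mat n n \<Longrightarrow> N (A * B) \<le> N A * N B"
  using assms zero_carrier_mat[of n n] unfolding multiplicative_norm_def by blast+

text \<open>Vectors are encoded as square matrices with equal columns, so that the given matrix norm
  applies to them and no compatible vector norm has to be constructed.\<close>

definition column_mat :: "nat \<Rightarrow> (nat \<Rightarrow> real) \<Rightarrow> real mat" where
  "column_mat n z = mat n n (\<lambda>(i, j). z i)"

lemma column_mat_carrier [simp]: "column_mat n z \<in> carrier_mat n n"
  by (simp add: column_mat_def)

lemma mult_column_mat:
  assumes "A \<in> carrier_mat n n"
  shows "A * column_mat n z = column_mat n (\<lambda>i. \<Sum>k<n. A $$ (i, k) * z k)"
  using assms
  by (intro eq_matI) (auto simp: column_mat_def scalar_prod_def lessThan_atLeast0)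

text \<open>The easy half of the equivalence of norms, by expansion in basis columns; the induction
  fills in one coordinate at a time.\<close>

lemma norm_column_mat_le:
  assumes N: "multiplicative_norm n N"
  shows "\<exists>K\<ge>0. \<forall>z. N (column_mat n z) \<le> K * (\<Sum>i<n. \<bar>z i\<bar>)"
proof -
  define E where "E i = column_mat n (\<lambda>k. of_bool (k = i))" for i
  have E: "0 \<le> N (E i)" for i by (simp add: multiplicative_norm_nonneg[OF N] E_def)
  have le: "N (column_mat n (\<lambda>k. if k < m then z k else 0)) \<le> (\<Sum>i<m. \<bar>z i\<bar> * N (E i))" for m z
  proof (induction m)
    case 0
    have "column_mat n (\<lambda>k. 0) = 0\<^sub>m n n" by (auto simp: column_mat_def)
    then show ?case by (simp add: multiplicative_norm_zero[OF N])
  next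
    case (Suc m)
    have "column_mat n (\<lambda>k. if k < Suc m then z k else 0)
        = column_mat n (\<lambda>k. if k < m then z k else 0) + z m \<cdot>\<^sub>m E m"
      by (intro eq_matI) (auto simp: column_mat_def E_def less_Suc_eq)
    then have "N (column_mat n (\<lambda>k. if k < Suc m then z k else 0))
        \<le> N (column_mat n (\<lambda>k. if k < m then z k else 0)) + N (z m \<cdot>\<^sub>m E m)"
      by (simp add: multiplicative_norm_add[OF N] E_def)
    also have "N (z m \<cdot>\<^sub>m E m) = \<bar>z m\<bar> * N (E m)"
      by (simp add: multiplicative_norm_smult[OF N] E_def)
    finally show ?case using Suc by simp
  qed
  show ?thesis
  proof (intro exI conjI allI)
    show "0 \<le> (\<Sum>i<n. N (E i))" using E by (intro sum_nonneg) auto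
    fix z
    have "column_mat n z = column_mat n (\<lambda>k. if k < n then z k else 0)"
      by (intro eq_matI) (auto simp: column_mat_def)
    then have "N (column_mat n z) \<le> (\<Sum>i<n. \<bar>z i\<bar> * N (E i))" using le[of n z] by simp
    also have "\<dots> \<le> (\<Sum>i<n. \<bar>z i\<bar> * (\<Sum>i<n. N (E i)))"
      using E by (intro sum_mono mult_left_mono member_le_sum) auto
    finally show "N (column_mat n z) \<le> (\<Sum>i<n. N (E i)) * (\<Sum>i<n. \<bar>z i\<bar>)"
      by (simp add: sum_distrib_right mult.commute)
  qed
qed

text \<open>Cutting out one entry with matrix units, \<open>E\<^sub>i\<^sub>i Z E\<^sub>i\<^sub>i = z\<^sub>i E\<^sub>i\<^sub>i\<close>, bounds it by the norm.\<close>

lemma le_norm_column_mat: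
  assumes N: "multiplicative_norm n N"
  shows "\<exists>K\<ge>0. \<forall>z. (\<Sum>i<n. \<bar>z i\<bar>) \<le> K * N (column_mat n z)"
proof -
  define E :: "nat \<Rightarrow> real mat" where "E i = mat n n (\<lambda>(a, b). of_bool (a = i \<and> b = i))" for i
  have E[simp]: "E i \<in> carrier_mat n n" for i by (simp add: E_def)
  have N0: "0 \<le> N A" if "A \<in> carrier_mat n n" for A
    using that by (rule multiplicative_norm_nonneg[OF N])
  have le: "\<bar>z i\<bar> \<le> N (E i) * N (column_mat n z)" if i: "i < n" for z i
  proof -
    let ?Z = "column_mat n z"
    \<comment> \<open>The estimate below has \<open>N (E i)\<close> once on the left and twice on
      the right; cancelling one factor requires it to be nonzero.\<close>
    have "E i \<noteq> 0\<^sub>m n n"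
    proof
      assume "E i = 0\<^sub>m n n"
      then have "E i $$ (i, i) = 0\<^sub>m n n $$ (i, i)" by simp
      with i show False by (simp add: E_def)
    qed
    then have pos: "0 < N (E i)"
      using N0[OF E, of i] multiplicative_norm_eq_0_iff[OF N E] by (simp add: order_le_less)
    have EZ: "E i * ?Z = column_mat n (\<lambda>k. of_bool (k = i) * z i)"
      unfolding mult_column_mat[OF E]
      using i by (intro eq_matI) (auto simp: column_mat_def E_def of_bool_def if_distrib[of "\<lambda>x. x * _"] cong: if_cong)
    have eq: "E i * ?Z * E i = z i \<cdot>\<^sub>m E i"
      unfolding EZ using i
      by (intro eq_matI)
         (auto simp: column_mat_def E_def scalar_prod_def of_bool_def if_distrib[of "\<lambda>x. _ * x"] cong: if_cong)
    have "\<bar>z i\<bar> * N (E i) = N (E i * ?Z * E i)"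
      unfolding eq by (simp add: multiplicative_norm_smult[OF N])
    also have "\<dots> \<le> N (E i * ?Z) * N (E i)"
      by (intro multiplicative_norm_mult[OF N] mult_carrier_mat[of _ n n]) auto
    also have "\<dots> \<le> N (E i) * N ?Z * N (E i)"
      using pos by (intro mult_right_mono multiplicative_norm_mult[OF N]) auto
    finally show ?thesis using pos by (simp add: mult.commute)
  qed
  show ?thesis
  proof (intro exI conjI allI)
    show "0 \<le> (\<Sum>i<n. N (E i))" using N0 by (intro sum_nonneg) auto
    fix z
    have "(\<Sum>i<n. \<bar>z i\<bar>) \<le> (\<Sum>i<n. N (E i) * N (column_mat n z))"
      using le by (intro sum_mono) auto
    then show "(\<Sum>i<n. \<bar>z i\<bar>) \<le> (\<Sum>i<n. N (E i)) * N (column_mat n z)"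
      by (simp add: sum_distrib_right)
  qed
qed

lemma left_product_carrier:
  assumes "\<And>k. C k \<in> carrier_mat n n"
  shows "left_product n C t \<in> carrier_mat n n"
  using assms by (induction t) (auto intro: mult_carrier_mat)

text \<open>The homogeneous part keeps the norm of the whole product, since that is the contracting
  quantity; a bound factor by factor would lose it. For the inhomogeneous part the crude factor
  \<open>L ^ t\<close> suffices, because \<open>t\<close> will be the fixed block length.\<close>

lemma matrix_recursion_unfold:
  assumes N: "multiplicative_norm n N"
    and C: "\<And>u. C u \<in> carrier_mat n n" and B: "\<And>u. B u \<in> carrier_mat n n"
    and Z: "\<And>u. Z u \<in> carrier_mat n n"
    and rec: "\<And>u. Z u = C u * Z (u - 1) + B u"
    and L: "\<And>u. N (C u) \<le> L" "1 \<le> L"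
  shows "N (Z (a + int t)) \<le> N (left_product n (\<lambda>k. C (a + k)) t) * N (Z a)
           + L ^ t * (\<Sum>u=1..t. N (B (a + int u)))"
proof -
  have N0: "0 \<le> N A" if "A \<in> carrier_mat n n" for A
    using that by (rule multiplicative_norm_nonneg[OF N])
  have add: "N (A + A') \<le> N A + N A'" and mult: "N (A * A') \<le> N A * N A'"
    if "A \<in> carrier_mat n n" "A' \<in> carrier_mat n n" for A A'
    using that multiplicative_norm_add[OF N] multiplicative_norm_mult[OF N] by blast+
  let ?P = "left_product n (\<lambda>k. C (a + k))"
  have P: "?P t \<in> carrier_mat n n" for t by (rule left_product_carrier) (rule C)
  have "\<exists>R \<in> carrier_mat n n. Z (a + int t) = ?P t * Z a + R \<and> N R \<le> L ^ t * (\<Sum>u=1..t. N (B (a + int u)))"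
  proof (induction t)
    case 0
    then show ?case using Z[of a] by (intro bexI[of _ "0\<^sub>m n n"]) (auto simp: multiplicative_norm_zero[OF N])
  next
    case (Suc t)
    let ?u = "a + int (Suc t)"
    from Suc obtain R where R: "R \<in> carrier_mat n n" "Z (a + int t) = ?P t * Z a + R"
      "N R \<le> L ^ t * (\<Sum>u=1..t. N (B (a + int u)))" by blast
    have CR: "C ?u * R \<in> carrier_mat n n" using C R(1) by (rule mult_carrier_mat)
    have PZ: "?P t * Z a \<in> carrier_mat n n" using P Z by (rule mult_carrier_mat)
    have "Z ?u = C ?u * Z (a + int t) + B ?u" using rec[of ?u] by simp
    also have "\<dots> = C ?u * (?P t * Z a) + C ?u * R + B ?u"
      unfolding R(2) using mult_add_distrib_mat[OF C PZ R(1)] by simp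
    also have "C ?u * (?P t * Z a) = ?P (Suc t) * Z a"
      using assoc_mult_mat[OF C P Z] by simp
    also have "?P (Suc t) * Z a + C ?u * R + B ?u = ?P (Suc t) * Z a + (C ?u * R + B ?u)"
      by (rule assoc_add_mat[OF mult_carrier_mat[OF P Z] CR B])
    finally have eq: "Z ?u = ?P (Suc t) * Z a + (C ?u * R + B ?u)" .
    have "N (C ?u * R + B ?u) \<le> N (C ?u * R) + N (B ?u)" using CR B by (rule add)
    also have "N (C ?u * R) \<le> N (C ?u) * N R" using C R(1) by (rule mult)
    also have "\<dots> \<le> L * (L ^ t * (\<Sum>u=1..t. N (B (a + int u))))"
      using L R N0 by (intro mult_mono) auto
    also have "N (B ?u) \<le> L ^ Suc t * N (B ?u)"
      using mult_right_mono[OF one_le_power[OF L(2), of "Suc t"] N0[OF B]] by simp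
    finally have "N (C ?u * R + B ?u) \<le> L ^ Suc t * (\<Sum>u=1..Suc t. N (B (a + int u)))"
      by (simp add: algebra_simps)
    then show ?case using eq CR B by (intro bexI[of _ "C ?u * R + B ?u"]) auto
  qed
  then obtain R where R: "R \<in> carrier_mat n n" "Z (a + int t) = ?P t * Z a + R"
      "N R \<le> L ^ t * (\<Sum>u=1..t. N (B (a + int u)))" by blast
  have "N (Z (a + int t)) \<le> N (?P t * Z a) + N R"
    unfolding R(2) using P Z R by (intro add) (auto intro: mult_carrier_mat)
  also have "N (?P t * Z a) \<le> N (?P t) * N (Z a)" using P Z by (rule mult)
  finally show ?thesis using R(3) by simp
qed

section \<open>The state recursion\<close>

text \<open>The vector z_t of the overview. Splitting the past log squares by the sign of \<epsilon>
  makes the asymmetric equation linear, with random coefficients that depend only on the sign of the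
  current innovation. Where \<epsilon> vanishes both indicators are 0, so the value of
  \<open>ln 0\<close> is irrelevant.\<close>

definition garch_state :: "nat \<Rightarrow> (int \<Rightarrow> real) \<Rightarrow> (int \<Rightarrow> real) \<Rightarrow> int \<Rightarrow> nat \<Rightarrow> real" where
  "garch_state q \<epsilon> \<sigma> t i =
     (if i < q then of_bool (\<epsilon> (t - int i) > 0) * ln ((\<epsilon> (t - int i))\<^sup>2)
      else if i < 2 * q then of_bool (\<epsilon> (t - int (i - q)) < 0) * ln ((\<epsilon> (t - int (i - q)))\<^sup>2)
      else ln ((\<sigma> (t - int (i - 2 * q)))\<^sup>2))"

text \<open>The vector b_t of the overview. The log of the squared innovation enters the two
  \<epsilon>-rows because log \<epsilon>^2 is the sum of log \<sigma>^2 and log \<eta>^2; the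
  volatility row receives only \<omega>.\<close>

definition garch_shock :: "nat \<Rightarrow> real \<Rightarrow> real \<Rightarrow> nat \<Rightarrow> real" where
  "garch_shock q \<omega> e i =
     (if 0 < q \<and> i = 0 then of_bool (e > 0) * (\<omega> + ln (e\<^sup>2))
      else if 0 < q \<and> i = q then of_bool (e < 0) * (\<omega> + ln (e\<^sup>2))
      else if i = 2 * q then \<omega> else 0)"

lemma garch_matrix_carrier [simp]: "garch_matrix p q \<alpha>p \<alpha>m \<beta> e \<in> carrier_mat (2 * q + p) (2 * q + p)"
  by (simp add: garch_matrix_def)

text \<open>Only three matrices can occur. Both the uniform norm bound and the measurability of the
  products rest on this.\<close>

lemma garch_matrix_sgn: "garch_matrix p q \<alpha>p \<alpha>m \<beta> (sgn e) = garch_matrix p q \<alpha>p \<alpha>m \<beta> e"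
  by (simp add: garch_matrix_def)

lemma sum_lessThan_add:
  fixes f :: "nat \<Rightarrow> 'a::comm_monoid_add"
  shows "(\<Sum>i<m + n. f i) = (\<Sum>i<m. f i) + (\<Sum>i<n. f (m + i))"
  by (induction n) (simp_all add: add.assoc)

lemma sum_coeff_row_garch_state:
  "(\<Sum>j<2 * q + p. coeff_row q \<alpha>p \<alpha>m \<beta> j * garch_state q \<epsilon> \<sigma> (t - 1) j) =
     (\<Sum>i=1..q. (\<alpha>p i * of_bool (\<epsilon> (t - int i) > 0) + \<alpha>m i * of_bool (\<epsilon> (t - int i) < 0))
                   * ln ((\<epsilon> (t - int i))\<^sup>2))
     + (\<Sum>j=1..p. \<beta> j * ln ((\<sigma> (t - int j))\<^sup>2))"
  \<comment> \<open>The range splits as q + q + p, one piece per block of the state. Entry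
    \<open>i\<close> of a block at time t - 1 is lag i + 1, matching coefficients counted from
    1.\<close>
  unfolding mult_2 sum_lessThan_add
  by (simp add: sum.atLeast1_atMost_eq coeff_row_def garch_state_def sum.distrib[symmetric] algebra_simps)

text \<open>A positive volatility lets \<epsilon> and the innovation share their sign, so the
  indicators in matrix and state agree. A zero innovation fits in: both sides of the two
  \<epsilon>-rows are then 0.\<close>

lemma garch_state_recursion:
  assumes "0 < \<sigma> t" and eps: "\<epsilon> t = \<sigma> t * e"
    and vol: "ln ((\<sigma> t)\<^sup>2) = \<omega>
       + (\<Sum>j<2 * q + p. coeff_row q \<alpha>p \<alpha>m \<beta> j * garch_state q \<epsilon> \<sigma> (t - 1) j)"
  shows "column_mat (2 * q + p) (garch_state q \<epsilon> \<sigma> t) =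
     garch_matrix p q \<alpha>p \<alpha>m \<beta> e * column_mat (2 * q + p) (garch_state q \<epsilon> \<sigma> (t - 1))
     + column_mat (2 * q + p) (garch_shock q \<omega> e)"
proof -
  let ?n = "2 * q + p"
  let ?C = "garch_matrix p q \<alpha>p \<alpha>m \<beta> e"
  have sgn: "\<epsilon> t > 0 \<longleftrightarrow> e > 0" "\<epsilon> t < 0 \<longleftrightarrow> e < 0"
    using assms(1) by (auto simp: eps zero_less_mult_iff mult_less_0_iff)
  have ln: "ln ((\<epsilon> t)\<^sup>2) = ln ((\<sigma> t)\<^sup>2) + ln (e\<^sup>2)" if "e \<noteq> 0"
    using assms(1) that by (simp add: eps power_mult_distrib ln_mult_pos)
  have "garch_state q \<epsilon> \<sigma> t i = (\<Sum>k<?n. ?C $$ (i, k) * garch_state q \<epsilon> \<sigma> (t - 1) k) + garch_shock q \<omega> e i"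
    if i: "i < ?n" for i
  proof -
    \<comment> \<open>For \<open>q = 0\<close> the indices 0, \<open>q\<close> and
      \<open>2 * q\<close> coincide and denote the volatility row; the guards \<open>0 < q\<close>
      keep the first two cases away from it.\<close>
    consider "0 < q \<and> i = 0" | "0 < q \<and> i = q" | "i = 2 * q"
      | i' where "i = Suc i'" "i \<noteq> q" "i \<noteq> 2 * q"
      by (cases i) auto
    then show ?thesis
    proof cases
      case 1
      then have "(\<Sum>k<?n. ?C $$ (i, k) * garch_state q \<epsilon> \<sigma> (t - 1) k) = of_bool (e > 0) * (ln ((\<sigma> t)\<^sup>2) - \<omega>)"
        using i by (auto simp: garch_matrix_def vol sum_distrib_left mult.assoc)
      with 1 show ?thesis using ln by (auto simp: garch_state_def garch_shock_def sgn)
    next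
      case 2
      then have "(\<Sum>k<?n. ?C $$ (i, k) * garch_state q \<epsilon> \<sigma> (t - 1) k) = of_bool (e < 0) * (ln ((\<sigma> t)\<^sup>2) - \<omega>)"
        using i by (auto simp: garch_matrix_def vol sum_distrib_left mult.assoc)
      with 2 show ?thesis using ln by (auto simp: garch_state_def garch_shock_def sgn)
    next
      case 3
      then have "?C $$ (i, k) = coeff_row q \<alpha>p \<alpha>m \<beta> k" if "k < ?n" for k
        using i that by (auto simp: garch_matrix_def)
      then have "(\<Sum>k<?n. ?C $$ (i, k) * garch_state q \<epsilon> \<sigma> (t - 1) k) = ln ((\<sigma> t)\<^sup>2) - \<omega>"
        unfolding vol by simp
      with 3 show ?thesis by (auto simp: garch_state_def garch_shock_def)
    next
      case 4
      then have "(\<Sum>k<?n. ?C $$ (i, k) * garch_state q \<epsilon> \<sigma> (t - 1) k) = (\<Sum>k<?n. of_bool (k = i') * garch_state q \<epsilon> \<sigma> (t - 1) k)"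
        using i by (intro sum.cong) (auto simp: garch_matrix_def)
      also have "\<dots> = garch_state q \<epsilon> \<sigma> (t - 1) i'"
        using i 4 by (simp add: of_bool_def if_distrib[of "\<lambda>x. x * _"] cong: if_cong)
      \<comment> \<open>A shift row: lag j - 1 seen from t - 1 is lag j seen from t. As
        \<open>i\<close> does not head a block, its predecessor \<open>i'\<close> lies in the same
        block.\<close>
      also have "\<dots> = garch_state q \<epsilon> \<sigma> t i"
        using 4 by (auto simp: garch_state_def Suc_diff_le algebra_simps of_nat_diff)
      finally show ?thesis using 4 by (simp add: garch_shock_def)
    qed
  qed
  then show ?thesis
    unfolding mult_column_mat[OF garch_matrix_carrier]
    by (intro eq_matI) (auto simp: column_mat_def)
qed

lemma sum_abs_garch_shock_le:
  "(\<Sum>i<n. \<bar>garch_shock q \<omega> e i\<bar>) \<le> real n * (\<bar>\<omega>\<bar> + \<bar>ln (e\<^sup>2)\<bar>)"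
proof -
  have "\<bar>garch_shock q \<omega> e i\<bar> \<le> \<bar>\<omega>\<bar> + \<bar>ln (e\<^sup>2)\<bar>" for i
    unfolding garch_shock_def by (auto simp: of_bool_def intro: order_trans[OF abs_triangle_ineq])
  then show ?thesis
    using sum_bounded_above[of "{..<n}" "\<lambda>i. \<bar>garch_shock q \<omega> e i\<bar>"] by simp
qed

section \<open>Blocks of innovations\<close>

text \<open>Simple functions stand in for measurability of matrix-valued maps: they need no
  sigma-algebra on matrices, and composing them with an arbitrary norm gives a measurable real
  function.\<close>

lemma simple_function_left_product:
  assumes "\<And>u. 1 \<le> u \<Longrightarrow> u \<le> int t \<Longrightarrow> simple_function S (C u)"
  shows "simple_function S (\<lambda>x. left_product n (\<lambda>u. C u x) t)"
  using assms
proof (induction t)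
  case (Suc t)
  have "simple_function S (\<lambda>x. C (int (Suc t)) x * left_product n (\<lambda>u. C u x) t)"
    by (rule simple_function_compose2) (use Suc in auto)
  then show ?case by simp
qed simp

lemma simple_function_garch_matrix:
  assumes [measurable]: "f \<in> borel_measurable S"
  shows "simple_function S (\<lambda>x. garch_matrix p q \<alpha>p \<alpha>m \<beta> (f x))"
proof -
  have "finite ((\<lambda>x. sgn (f x)) ` space S)"
    by (rule finite_subset[of _ "{-1, 0, 1}"]) (auto simp: sgn_real_def)
  then have "simple_function S (\<lambda>x. sgn (f x))"
    by (intro simple_function_borel_measurable) (auto simp: sgn_real_def)
  from simple_function_compose1[OF this, of "garch_matrix p q \<alpha>p \<alpha>m \<beta>"]
  show ?thesis by (simp add: garch_matrix_sgn)
qed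

text \<open>The law of a window is independent of its position \<open>a\<close>, so all blocks share
  one law.\<close>

lemma (in prob_space) distr_iid_block:
  assumes iid: "iid M \<eta>" and I: "I \<noteq> {}"
  shows "distr M (\<Pi>\<^sub>M u\<in>I. borel) (\<lambda>x. \<lambda>u\<in>I. \<eta> (a + u) x) = (\<Pi>\<^sub>M u\<in>I. distr M borel (\<eta> 0))"
proof -
  have ind: "indep_vars (\<lambda>_. borel) \<eta> UNIV" and law: "\<And>t. distr M borel (\<eta> t) = distr M borel (\<eta> 0)"
    using iid by (auto simp: iid_def)
  have meas: "\<eta> t \<in> borel_measurable M" for t using ind by (auto simp: indep_vars_def)
  have "indep_vars (\<lambda>_. borel) (\<lambda>u. \<eta> (a + u)) I"
  proof -
    \<comment> \<open>Reindexing by a shift is obtained by grouping the indices into the singletons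
      {a + u}, which are disjoint for different \<open>u\<close>.\<close>
    have "indep_vars (\<lambda>u. \<Pi>\<^sub>M v\<in>{a + u}. borel) (\<lambda>u x. \<lambda>v\<in>{a + u}. \<eta> v x) I"
      by (rule indep_vars_restrict[OF ind]) (auto simp: disjoint_family_on_def)
    then have "indep_vars (\<lambda>_. borel) (\<lambda>u x. (\<lambda>w. w (a + u)) (\<lambda>v\<in>{a + u}. \<eta> v x)) I"
      by (rule indep_vars_compose2) (rule measurable_component_singleton, simp)
    then show ?thesis by simp
  qed
  then have "distr M (\<Pi>\<^sub>M u\<in>I. borel) (\<lambda>x. \<lambda>u\<in>I. \<eta> (a + u) x) = (\<Pi>\<^sub>M u\<in>I. distr M borel (\<eta> (a + u)))"
    using indep_vars_iff_distr_eq_PiM'[OF I, of "\<lambda>u. \<eta> (a + u)" "\<lambda>_. borel"] meas by simp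
  also have "\<dots> = (\<Pi>\<^sub>M u\<in>I. distr M borel (\<eta> 0))" by (intro PiM_cong law) simp
  finally show ?thesis .
qed

text \<open>Disjoint groups of independent variables are independent; each group is then relabelled
  by the common index set \<open>I\<close>, so that all blocks take values in one space.\<close>

lemma (in prob_space) indep_vars_iid_blocks:
  assumes iid: "iid M \<eta>"
    and disj: "disjoint_family (\<lambda>m. (\<lambda>u. a m + u) ` I)"
  shows "indep_vars (\<lambda>_. \<Pi>\<^sub>M u\<in>I. borel) (\<lambda>m x. \<lambda>u\<in>I. \<eta> (a m + u) x) UNIV"
proof -
  have ind: "indep_vars (\<lambda>_. borel) \<eta> UNIV" using iid by (auto simp: iid_def)
  define K where "K m = (\<lambda>u. a m + u) ` I" for m
  have "indep_vars (\<lambda>m. \<Pi>\<^sub>M u\<in>K m. borel) (\<lambda>m x. \<lambda>u\<in>K m. \<eta> u x) UNIV"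
    by (rule indep_vars_restrict[OF ind]) (use disj in \<open>auto simp: K_def\<close>)
  then have "indep_vars (\<lambda>_. \<Pi>\<^sub>M u\<in>I. borel) (\<lambda>m x. (\<lambda>w. \<lambda>u\<in>I. w (a m + u)) (\<lambda>u\<in>K m. \<eta> u x)) UNIV"
    by (rule indep_vars_compose2)
       (intro measurable_restrict measurable_component_singleton, auto simp: K_def)
  also have "(\<lambda>m x. (\<lambda>w. \<lambda>u\<in>I. w (a m + u)) (\<lambda>u\<in>K m. \<eta> u x)) = (\<lambda>m x. \<lambda>u\<in>I. \<eta> (a m + u) x)"
    by (auto simp: K_def fun_eq_iff)
  finally show ?thesis .
qed

text \<open>\<open>F\<close> and \<open>G\<close> of the same block may be dependent. In the second
  product \<open>G\<close> meets only earlier blocks, which is the shape of the terms of the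
  unfolded recursion.\<close>

lemma (in prob_space) nn_integral_iid_blocks:
  fixes F G :: "'b \<Rightarrow> ennreal" and n :: nat
  assumes ind: "indep_vars (\<lambda>_. S) X UNIV" and law: "\<And>m. distr M S (X m) = D"
    and F[measurable]: "F \<in> borel_measurable S" and G[measurable]: "G \<in> borel_measurable S"
  shows "(\<integral>\<^sup>+x. (\<Prod>i<n. F (X i x)) \<partial>M) = (\<integral>\<^sup>+y. F y \<partial>D) ^ n"
    and "(\<integral>\<^sup>+x. (\<Prod>i<n. F (X i x)) * G (X n x) \<partial>M) = (\<integral>\<^sup>+y. F y \<partial>D) ^ n * (\<integral>\<^sup>+y. G y \<partial>D)"
proof -
  have [measurable]: "X m \<in> measurable M S" for m using ind by (auto simp: indep_vars_def)
  have int: "(\<integral>\<^sup>+x. H (X m x) \<partial>M) = (\<integral>\<^sup>+y. H y \<partial>D)" if [measurable]: "H \<in> borel_measurable S" for H m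
    unfolding law[of m, symmetric] by (rule nn_integral_distr[symmetric]) auto
  have prod: "(\<integral>\<^sup>+x. (\<Prod>i<k. H i (X i x)) \<partial>M) = (\<Prod>i<k. \<integral>\<^sup>+y. H i y \<partial>D)"
    if H: "\<And>i. H i \<in> borel_measurable S" for H :: "nat \<Rightarrow> 'b \<Rightarrow> ennreal" and k :: nat
  proof -
    have "indep_vars (\<lambda>_. borel) (\<lambda>i x. H i (X i x)) {..<k}"
      using indep_vars_compose2[OF ind, of H "\<lambda>_. borel"] H by (auto intro: indep_vars_subset)
    then show ?thesis using H by (subst indep_vars_nn_integral) (auto simp: int)
  qed
  show "(\<integral>\<^sup>+x. (\<Prod>i<n. F (X i x)) \<partial>M) = (\<integral>\<^sup>+y. F y \<partial>D) ^ n"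
    using prod[of "\<lambda>_. F"] by simp
  have "(\<integral>\<^sup>+x. (\<Prod>i<Suc n. (if i < n then F else G) (X i x)) \<partial>M) = (\<Prod>i<Suc n. \<integral>\<^sup>+y. (if i < n then F else G) y \<partial>D)"
    by (rule prod) simp
  then show "(\<integral>\<^sup>+x. (\<Prod>i<n. F (X i x)) * G (X n x) \<partial>M) = (\<integral>\<^sup>+y. F y \<partial>D) ^ n * (\<integral>\<^sup>+y. G y \<partial>D)"
    by simp
qed

section \<open>Log moments and finite moments of order \<open>s\<close>\<close>

text \<open>Separates the two meanings of a finite log moment under log 0 = -infinity: no mass at 0,
  and a finite moment of the real \<open>ln\<close>. Afterwards only \<open>ln\<close> has to be
  handled.\<close>

lemma abs_log_moment_finite_iff:
  assumes [measurable]: "X \<in> borel_measurable M" and s: "0 < s"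
  shows "abs_log_moment M s X < \<infinity> \<longleftrightarrow>
    (AE x in M. 0 < X x) \<and> (\<integral>\<^sup>+x. ennreal (\<bar>ln (X x)\<bar> powr s) \<partial>M) < \<infinity>"
proof -
  let ?f = "\<lambda>x. if X x \<le> 0 then \<infinity> else ennreal (\<bar>ln (X x)\<bar> powr s)"
  have eq: "abs_log_moment M s X = (\<integral>\<^sup>+x. ?f x \<partial>M)"
    unfolding abs_log_moment_def by (intro nn_integral_cong) (auto simp: elog_def)
  show ?thesis
  proof
    assume fin: "abs_log_moment M s X < \<infinity>"
    then have "AE x in M. ?f x \<noteq> \<infinity>"
      unfolding eq by (intro nn_integral_PInf_AE) auto
    then have pos: "AE x in M. 0 < X x" by eventually_elim (auto split: if_splits)
    then have "(\<integral>\<^sup>+x. ennreal (\<bar>ln (X x)\<bar> powr s) \<partial>M) = (\<integral>\<^sup>+x. ?f x \<partial>M)"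
      by (intro nn_integral_cong_AE) auto
    with fin eq pos show "(AE x in M. 0 < X x) \<and> (\<integral>\<^sup>+x. ennreal (\<bar>ln (X x)\<bar> powr s) \<partial>M) < \<infinity>"
      by simp
  next
    assume a: "(AE x in M. 0 < X x) \<and> (\<integral>\<^sup>+x. ennreal (\<bar>ln (X x)\<bar> powr s) \<partial>M) < \<infinity>"
    then have "(\<integral>\<^sup>+x. ennreal (\<bar>ln (X x)\<bar> powr s) \<partial>M) = (\<integral>\<^sup>+x. ?f x \<partial>M)"
      by (intro nn_integral_cong_AE) auto
    with a eq show "abs_log_moment M s X < \<infinity>" by simp
  qed
qed

lemma nn_integral_powr_sum_finite:
  fixes f :: "'i \<Rightarrow> 'a \<Rightarrow> real"
  assumes "finite A" and s: "0 < s" "s \<le> 1"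
    and [measurable]: "\<And>i. i \<in> A \<Longrightarrow> f i \<in> borel_measurable M"
    and f: "\<And>i x. i \<in> A \<Longrightarrow> 0 \<le> f i x"
    and fin: "\<And>i. i \<in> A \<Longrightarrow> (\<integral>\<^sup>+x. ennreal (f i x powr s) \<partial>M) < \<infinity>"
  shows "(\<integral>\<^sup>+x. ennreal ((\<Sum>i\<in>A. f i x) powr s) \<partial>M) < \<infinity>"
proof -
  have "(\<integral>\<^sup>+x. ennreal ((\<Sum>i\<in>A. f i x) powr s) \<partial>M) \<le> (\<integral>\<^sup>+x. (\<Sum>i\<in>A. ennreal (f i x powr s)) \<partial>M)"
  proof (rule nn_integral_mono)
    fix x
    have "(\<Sum>i\<in>A. f i x) powr s \<le> (\<Sum>i\<in>A. f i x powr s)"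
      using assms by (intro powr_sum_le_sum_powr) auto
    then show "ennreal ((\<Sum>i\<in>A. f i x) powr s) \<le> (\<Sum>i\<in>A. ennreal (f i x powr s))"
      by (simp add: ennreal_leI)
  qed
  also have "\<dots> = (\<Sum>i\<in>A. \<integral>\<^sup>+x. ennreal (f i x powr s) \<partial>M)"
    by (rule nn_integral_sum) simp
  also have "\<dots> < \<infinity>" using fin \<open>finite A\<close> by simp
  finally show ?thesis .
qed

lemma nn_integral_powr_cmult_finite:
  fixes f :: "'a \<Rightarrow> real"
  assumes [measurable]: "f \<in> borel_measurable M"
    and fin: "(\<integral>\<^sup>+x. ennreal (f x powr s) \<partial>M) < \<infinity>"
  shows "(\<integral>\<^sup>+x. ennreal ((c * f x) powr s) \<partial>M) < \<infinity>"
proof -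
  have "(\<integral>\<^sup>+x. ennreal ((c * f x) powr s) \<partial>M) = ennreal (c powr s) * (\<integral>\<^sup>+x. ennreal (f x powr s) \<partial>M)"
    by (subst nn_integral_cmult[symmetric]) (auto simp: powr_mult ennreal_mult)
  also have "\<dots> < \<infinity>" using fin by (simp add: ennreal_mult_less_top)
  finally show ?thesis .
qed

lemma nn_integral_powr_add_finite:
  fixes f g :: "'a \<Rightarrow> real"
  assumes [measurable]: "f \<in> borel_measurable M" "g \<in> borel_measurable M"
    and nonneg: "\<And>x. 0 \<le> f x" "\<And>x. 0 \<le> g x" and s: "0 < s" "s \<le> 1"
    and fin: "(\<integral>\<^sup>+x. ennreal (f x powr s) \<partial>M) < \<infinity>" "(\<integral>\<^sup>+x. ennreal (g x powr s) \<partial>M) < \<infinity>"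
  shows "(\<integral>\<^sup>+x. ennreal ((f x + g x) powr s) \<partial>M) < \<infinity>"
proof -
  have "(\<integral>\<^sup>+x. ennreal ((if b then f x else g x) powr s) \<partial>M) < \<infinity>" for b
    using fin by (cases b) auto
  then have "(\<integral>\<^sup>+x. ennreal ((\<Sum>b\<in>UNIV. (if b then f x else g x)) powr s) \<partial>M) < \<infinity>"
    using nonneg s by (intro nn_integral_powr_sum_finite) auto
  then show ?thesis by (simp add: UNIV_bool add.commute)
qed

lemma (in prob_space) nn_integral_powr_exponent_mono:
  fixes f :: "'a \<Rightarrow> real"
  assumes [measurable]: "f \<in> borel_measurable M" and f: "\<And>x. 0 \<le> f x"
    and s: "0 < s" "s \<le> r" and fin: "(\<integral>\<^sup>+x. ennreal (f x powr r) \<partial>M) < \<infinity>"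
  shows "(\<integral>\<^sup>+x. ennreal (f x powr s) \<partial>M) < \<infinity>"
proof -
  have "(\<integral>\<^sup>+x. ennreal (f x powr s) \<partial>M) \<le> (\<integral>\<^sup>+x. 1 + ennreal (f x powr r) \<partial>M)"
  proof (rule nn_integral_mono)
    fix x
    have "f x powr s \<le> 1 + f x powr r"
    proof (cases "f x \<le> 1")
      case True
      then have "f x powr s \<le> 1" using f s by (intro powr_le1) auto
      then show ?thesis by (simp add: add_increasing2)
    next
      case False
      then have "f x powr s \<le> f x powr r" using s by (intro powr_mono) auto
      then show ?thesis by simp
    qed
    from ennreal_leI[OF this] show "ennreal (f x powr s) \<le> 1 + ennreal (f x powr r)" by simp
  qed
  also have "\<dots> < \<infinity>" using fin by (simp add: nn_integral_add emeasure_space_1)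
  finally show ?thesis .
qed

lemma left_product_cong:
  assumes "\<And>u. 1 \<le> u \<Longrightarrow> u \<le> int t \<Longrightarrow> C u = C' u"
  shows "left_product n C t = left_product n C' t"
  using assms by (induction t) auto

lemma norm_left_product_le:
  assumes N: "multiplicative_norm n N" and C: "\<And>u. C u \<in> carrier_mat n n" "\<And>u. N (C u) \<le> L"
  shows "N (left_product n C t) \<le> L ^ t * N (1\<^sub>m n)"
proof (induction t)
  case (Suc t)
  have "N (left_product n C (Suc t)) \<le> N (C (int (Suc t))) * N (left_product n C t)"
    unfolding left_product.simps by (intro multiplicative_norm_mult[OF N] left_product_carrier C)
  also have "\<dots> \<le> L * (L ^ t * N (1\<^sub>m n))"
    using Suc C(2) order_trans[OF multiplicative_norm_nonneg[OF N C(1)] C(2)]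
    by (intro mult_mono) (auto intro!: multiplicative_norm_nonneg[OF N] left_product_carrier C)
  finally show ?case by (simp add: mult.assoc)
qed simp

text \<open>The three possible norms are added up rather than maximised; the extra 1 provides
  \<open>1 \<le> L\<close>, which the unfolding over a block requires.\<close>

lemma norm_garch_matrix_bounded:
  assumes N: "multiplicative_norm (2 * q + p) N"
  shows "\<exists>L\<ge>1. \<forall>e. N (garch_matrix p q \<alpha>p \<alpha>m \<beta> e) \<le> L"
proof -
  let ?N = "\<lambda>e. N (garch_matrix p q \<alpha>p \<alpha>m \<beta> e)"
  have pos: "0 \<le> ?N e" for e by (intro multiplicative_norm_nonneg[OF N]) simp
  have "?N e \<le> 1 + ?N 1 + ?N 0 + ?N (- 1)" for e
  proof -
    have "?N e = ?N (sgn e)" by (simp only: garch_matrix_sgn)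
    also have "\<dots> \<le> 1 + ?N 1 + ?N 0 + ?N (- 1)"
      using pos[of 1] pos[of 0] pos[of "-1"] by (auto simp: sgn_real_def)
    finally show ?thesis .
  qed
  moreover have "1 \<le> 1 + ?N 1 + ?N 0 + ?N (- 1)" using pos[of 1] pos[of 0] pos[of "-1"] by linarith
  ultimately show ?thesis by blast
qed

section \<open>Stationarity of the state\<close>

lemma garch_state_measurable:
  assumes [measurable]: "\<And>u. \<epsilon> u \<in> borel_measurable M" "\<And>u. \<sigma> u \<in> borel_measurable M"
  shows "(\<lambda>x. garch_state q (\<lambda>u. \<epsilon> u x) (\<lambda>u. \<sigma> u x) t i) \<in> borel_measurable M"
  unfolding garch_state_def of_bool_def by measurable

text \<open>Exhibits the state at any time as one fixed functional of the shifted path, the form to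
  which stationarity applies.\<close>

lemma garch_state_shift:
  "garch_state q \<epsilon> \<sigma> t = garch_state q (\<lambda>u. \<epsilon> (u + t)) (\<lambda>u. \<sigma> (u + t)) 0"
proof -
  have "0 - c + t = t - c" for c by simp
  then show ?thesis by (intro ext) (simp only: garch_state_def)
qed

text \<open>The state involves several lags of both processes, so equality of the laws of whole
  paths is what is transported, by the functional \<open>F\<close>.\<close>

lemma distr_garch_state_stationary:
  fixes \<epsilon> \<sigma> :: "int \<Rightarrow> 'a \<Rightarrow> real" and n q :: nat
  assumes stat: "strictly_stationary M (borel \<Otimes>\<^sub>M borel) (\<lambda>t x. (\<epsilon> t x, \<sigma> t x))"
  defines "V \<equiv> \<lambda>t x. \<Sum>i<n. \<bar>garch_state q (\<lambda>u. \<epsilon> u x) (\<lambda>u. \<sigma> u x) t i\<bar>"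
  shows "distr M borel (V t) = distr M borel (V t')"
proof -
  let ?S = "\<Pi>\<^sub>M u\<in>(UNIV :: int set). (borel \<Otimes>\<^sub>M borel) :: (real \<times> real) measure"
  let ?path = "\<lambda>h x u. (\<epsilon> (u + h) x, \<sigma> (u + h) x)"
  define F :: "(int \<Rightarrow> real \<times> real) \<Rightarrow> real" where
    "F f = (\<Sum>i<n. \<bar>garch_state q (\<lambda>u. fst (f u)) (\<lambda>u. snd (f u)) 0 i\<bar>)" for f
  have F[measurable]: "F \<in> borel_measurable ?S"
    unfolding F_def[abs_def]
    by (intro borel_measurable_sum borel_measurable_abs garch_state_measurable) measurable
  have meas: "(\<lambda>x. (\<epsilon> u x, \<sigma> u x)) \<in> measurable M (borel \<Otimes>\<^sub>M borel)" for u
    using stat by (auto simp: strictly_stationary_def)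
  have path[measurable]: "?path h \<in> measurable M ?S" for h
    by (rule measurable_PiM_single') (use meas in \<open>auto simp: space_pair_measure\<close>)
  have "distr M borel (V h) = distr (distr M ?S (?path h)) borel F" for h
  proof -
    have "V h = F \<circ> ?path h"
      by (simp add: V_def F_def fun_eq_iff garch_state_shift[of q _ _ h])
    then show ?thesis by (simp add: distr_distr)
  qed
  moreover have "distr M ?S (?path h) = distr M ?S (?path 0)" for h
    using stat by (simp add: strictly_stationary_def)
  ultimately show ?thesis by simp
qed

lemma abs_log_moment_distr:
  assumes [measurable]: "Y \<in> borel_measurable M"
  shows "abs_log_moment M s (\<lambda>x. (Y x)\<^sup>2) = abs_log_moment (distr M borel Y) s (\<lambda>y. y\<^sup>2)"
proof -
  have [measurable]: "elog \<in> borel_measurable borel"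
    unfolding elog_def[abs_def] by measurable
  show ?thesis unfolding abs_log_moment_def by (subst nn_integral_distr) auto
qed

section \<open>The moment bound for the state\<close>

lemma (in prob_space) garch_state_moment_finite:
  fixes \<eta> \<epsilon> \<sigma> :: "int \<Rightarrow> 'a \<Rightarrow> real"
  assumes iid: "iid M \<eta>"
    and N: "multiplicative_norm (2 * q + p) N"
    and lyap: "top_lyapunov M (2 * q + p) N (\<lambda>t x. garch_matrix p q \<alpha>p \<alpha>m \<beta> (\<eta> t x)) < 0"
    and s0: "s0 > 0"
    and mom: "\<And>t. (\<integral>\<^sup>+x. ennreal (\<bar>ln ((\<eta> t x)\<^sup>2)\<bar> powr s0) \<partial>M) < \<infinity>"
    and meas: "\<And>t. \<epsilon> t \<in> borel_measurable M" "\<And>t. \<sigma> t \<in> borel_measurable M"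
    and rec: "\<And>t. AE x in M. 0 < \<sigma> t x \<and> \<epsilon> t x = \<sigma> t x * \<eta> t x \<and>
       ln ((\<sigma> t x)\<^sup>2) = \<omega> + (\<Sum>j<2 * q + p. coeff_row q \<alpha>p \<alpha>m \<beta> j
           * garch_state q (\<lambda>u. \<epsilon> u x) (\<lambda>u. \<sigma> u x) (t - 1) j)"
    and stat: "strictly_stationary M (borel \<Otimes>\<^sub>M borel) (\<lambda>t x. (\<epsilon> t x, \<sigma> t x))"
  shows "\<exists>s>0. s \<le> 1 \<and> s \<le> s0 \<and> (\<forall>t. (\<integral>\<^sup>+x. ennreal
    ((\<Sum>i<2 * q + p. \<bar>garch_state q (\<lambda>u. \<epsilon> u x) (\<lambda>u. \<sigma> u x) t i\<bar>) powr s) \<partial>M) < \<infinity>)"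
proof -
  define n where "n = 2 * q + p"
  note N = N[folded n_def]
  define C where "C = garch_matrix p q \<alpha>p \<alpha>m \<beta>"
  have C: "C e \<in> carrier_mat n n" for e by (simp add: C_def n_def)
  have [measurable]: "\<eta> t \<in> borel_measurable M" for t
    using iid by (auto simp: iid_def indep_vars_def)
  obtain L where L: "1 \<le> L" "\<And>e. N (C e) \<le> L"
    using norm_garch_matrix_bounded[of q p N \<alpha>p \<alpha>m \<beta>] N by (auto simp: C_def n_def)
  obtain k :: nat where k: "1 \<le> k"
    and neg: "ereal_expectation M (\<lambda>x. elog (N (left_product n (\<lambda>u. C (\<eta> u x)) k))) < 0"
  proof -
    from lyap obtain k :: nat where "1 \<le> k"
      "ereal_expectation M (\<lambda>x. elog (N (left_product n (\<lambda>u. C (\<eta> u x)) k))) / ereal (real k) < 0"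
      unfolding top_lyapunov_def INF_less_iff C_def n_def by auto
    moreover from this have "ereal_expectation M (\<lambda>x. elog (N (left_product n (\<lambda>u. C (\<eta> u x)) k))) < 0"
      by (cases "ereal_expectation M (\<lambda>x. elog (N (left_product n (\<lambda>u. C (\<eta> u x)) k)))")
         (auto simp: divide_less_0_iff)
    ultimately show ?thesis using that by blast
  qed
  define I where "I = {1..int k}"
  have I: "I \<noteq> {}" using k by (simp add: I_def)
  \<comment> \<open>\<open>S\<close> and \<open>D\<close> are the space and the law of a window of
    \<open>k\<close> innovations. \<open>H\<close> and \<open>G\<close> below are functions of a
    window, so one integral over \<open>D\<close> serves every block.\<close>
  define S where "S = (\<Pi>\<^sub>M u\<in>I. borel :: real measure)"
  define D where "D = (\<Pi>\<^sub>M u\<in>I. distr M borel (\<eta> 0))"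
  define H where "H w = N (left_product n (\<lambda>u. C (w u)) k)" for w :: "int \<Rightarrow> real"
  have H0: "0 \<le> H w" for w
    unfolding H_def by (intro multiplicative_norm_nonneg[OF N] left_product_carrier C)
  have H_cong: "H (\<lambda>u\<in>I. w u) = H w" for w
    unfolding H_def by (intro arg_cong[of _ _ N] left_product_cong) (simp add: I_def)
  \<comment> \<open>Stated for general \<open>f\<close> because it is used both for the innovations
    on the probability space and for the coordinates on \<open>S\<close>.\<close>
  have H_meas: "(\<lambda>x. H (\<lambda>u. f u x)) \<in> borel_measurable T"
    if "\<And>u. u \<in> I \<Longrightarrow> f u \<in> borel_measurable T" for f :: "int \<Rightarrow> 'c \<Rightarrow> real" and T
    unfolding H_def C_def
    by (intro borel_measurable_simple_function simple_function_compose1[of _ _ N]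
          simple_function_left_product simple_function_garch_matrix that) (auto simp: I_def)
  have H_S[measurable]: "H \<in> borel_measurable S"
    using H_meas[of "\<lambda>u w. w u" S] by (simp add: S_def measurable_component_singleton)
  obtain s where s: "0 < s" "s \<le> min 1 s0" and H_lt: "(\<integral>\<^sup>+x. ennreal (H (\<lambda>u. \<eta> u x) powr s) \<partial>M) < 1"
  proof -
    have "\<exists>s>0. s \<le> min 1 s0 \<and> (\<integral>\<^sup>+x. ennreal (H (\<lambda>u. \<eta> u x) powr s) \<partial>M) < 1"
    proof (rule ex_small_moment_less_one)
      show "(\<lambda>x. H (\<lambda>u. \<eta> u x)) \<in> borel_measurable M" by (rule H_meas) simp
      show "H (\<lambda>u. \<eta> u x) \<le> L ^ k * N (1\<^sub>m n)" for x
        unfolding H_def by (intro norm_left_product_le N C L)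
    qed (use H0 s0 neg in \<open>auto intro!: prob_space_axioms simp: H_def\<close>)
    then show ?thesis using that by blast
  qed
  obtain K1 where K1: "0 \<le> K1" "\<And>z. N (column_mat n z) \<le> K1 * (\<Sum>i<n. \<bar>z i\<bar>)"
    using norm_column_mat_le[OF N] by blast
  obtain K2 where K2: "0 \<le> K2" "\<And>z. (\<Sum>i<n. \<bar>z i\<bar>) \<le> K2 * N (column_mat n z)"
    using le_norm_column_mat[OF N] by blast
  define \<kappa> where "\<kappa> = max K1 K2"
  \<comment> \<open>Bounds the accumulated shocks of a block: \<open>L ^ k\<close> comes from the
    unfolding, \<open>K1\<close> from the norm of a column matrix, and \<open>real n\<close> from
    the number of entries of a shock.\<close>
  define G where "G w = (L ^ k * (K1 * real n)) * (\<Sum>u=1..k. \<bar>\<omega>\<bar> + \<bar>ln ((w (int u))\<^sup>2)\<bar>)"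
    for w :: "int \<Rightarrow> real"
  have G0: "0 \<le> G w" for w using K1 L by (auto simp: G_def intro!: mult_nonneg_nonneg sum_nonneg)
  have G_cong: "G (\<lambda>u\<in>I. w u) = G w" for w by (simp add: G_def I_def)
  have G_S[measurable]: "G \<in> borel_measurable S"
    unfolding G_def[abs_def] S_def
    by (intro borel_measurable_times borel_measurable_sum borel_measurable_add borel_measurable_abs
          borel_measurable_const borel_measurable_ln borel_measurable_power measurable_component_singleton)
       (auto simp: I_def)
  have law: "distr M S (\<lambda>x. \<lambda>u\<in>I. \<eta> (a + u) x) = D" for a
    unfolding S_def D_def by (rule distr_iid_block[OF iid I])
  have block_meas: "(\<lambda>x. \<lambda>u\<in>I. \<eta> (a + u) x) \<in> measurable M S" for a
    unfolding S_def by (rule measurable_restrict) simp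
  have int_D: "(\<integral>\<^sup>+y. f y \<partial>D) = (\<integral>\<^sup>+x. f (\<lambda>u\<in>I. \<eta> u x) \<partial>M)" if "f \<in> borel_measurable S" for f
    using nn_integral_distr[OF block_meas[of 0], of f] that law[of 0] by simp
  define \<rho> where "\<rho> = enn2real (\<integral>\<^sup>+y. ennreal (H y powr s) \<partial>D)"
  define b where "b = enn2real (\<integral>\<^sup>+y. ennreal (G y powr s) \<partial>D)"
  have "(\<integral>\<^sup>+y. ennreal (H y powr s) \<partial>D) < 1"
    using H_lt by (simp add: int_D H_cong)
  then have \<rho>: "(\<integral>\<^sup>+y. ennreal (H y powr s) \<partial>D) = ennreal \<rho>" "0 \<le> \<rho>" "\<rho> < 1"
    unfolding \<rho>_def by (cases "\<integral>\<^sup>+y. ennreal (H y powr s) \<partial>D"; auto simp: ennreal_less_one_iff)+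
  \<comment> \<open>Here \<open>s\<close> at most \<open>s0\<close> gives the moment of the
    innovations, and \<open>s\<close> at most 1 splits the sum.\<close>
  have "(\<integral>\<^sup>+x. ennreal (G (\<lambda>u. \<eta> u x) powr s) \<partial>M) < \<infinity>"
    unfolding G_def using s mom
    by (intro nn_integral_powr_cmult_finite nn_integral_powr_sum_finite nn_integral_powr_add_finite
          nn_integral_powr_exponent_mono[where r = s0 and s = s])
       (auto simp: emeasure_space_1)
  then have "(\<integral>\<^sup>+y. ennreal (G y powr s) \<partial>D) < \<infinity>"
    by (simp add: int_D G_cong)
  then have b: "(\<integral>\<^sup>+y. ennreal (G y powr s) \<partial>D) = ennreal b" "0 \<le> b"
    by (auto simp: b_def)
  define z where "z t x = garch_state q (\<lambda>u. \<epsilon> u x) (\<lambda>u. \<sigma> u x) t" for t x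
  have rec_z: "AE x in M. \<forall>t. column_mat n (z t x) =
      C (\<eta> t x) * column_mat n (z (t - 1) x) + column_mat n (garch_shock q \<omega> (\<eta> t x))"
    unfolding AE_all_countable
  proof
    fix t
    show "AE x in M. column_mat n (z t x) =
      C (\<eta> t x) * column_mat n (z (t - 1) x) + column_mat n (garch_shock q \<omega> (\<eta> t x))"
      using rec[of t] unfolding z_def C_def n_def
      by eventually_elim (rule garch_state_recursion, auto)
  qed
  have "(\<integral>\<^sup>+x. ennreal ((\<Sum>i<n. \<bar>z t x i\<bar>) powr s) \<partial>M) < \<infinity>" for t
  proof -
    \<comment> \<open>Times going back from \<open>t\<close> in steps of \<open>k\<close>. The
      window \<open>X m\<close> holds the innovations that lead from time \<tau> (m + 1) to time
      \<tau> m.\<close>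
    define \<tau> where "\<tau> m = t - int m * int k" for m
    define X where "X m x = (\<lambda>u\<in>I. \<eta> (\<tau> (Suc m) + u) x)" for m x
    have \<tau>_Suc: "\<tau> m = \<tau> (Suc m) + int k" for m by (simp add: \<tau>_def algebra_simps)
    have [measurable]: "X m \<in> measurable M S" for m unfolding X_def[abs_def] by (rule block_meas)
    have ind: "indep_vars (\<lambda>_. S) X UNIV"
      unfolding X_def[abs_def] S_def
    proof (rule indep_vars_iid_blocks[OF iid], unfold disjoint_family_on_def, intro ballI impI)
      have disj: "(\<lambda>u. \<tau> (Suc m) + u) ` I \<inter> (\<lambda>u. \<tau> (Suc m') + u) ` I = {}" if "m < m'" for m m'
      proof -
        \<comment> \<open>The later-numbered block lies earlier in time. It ends at or before \<tau>
          (m + 1), a time that block \<open>m\<close> omits because \<open>I\<close> starts at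
          1.\<close>
        have "int (Suc m) * int k \<le> int m' * int k"
          using that by (intro mult_right_mono) auto
        then have "\<tau> m' \<le> \<tau> (Suc m)" by (simp add: \<tau>_def)
        then show ?thesis using \<tau>_Suc[of m'] by (auto simp: I_def)
      qed
      fix m m' :: nat assume "m \<noteq> m'"
      then show "(\<lambda>u. \<tau> (Suc m) + u) ` I \<inter> (\<lambda>u. \<tau> (Suc m') + u) ` I = {}"
        using disj[of m m'] disj[of m' m] by (metis Int_commute linorder_neqE_nat)
    qed
    have X_law: "distr M S (X m) = D" for m unfolding X_def[abs_def] by (rule law)
    note blocks = nn_integral_iid_blocks[OF ind X_law, of "\<lambda>y. ennreal (H y powr s)" "\<lambda>y. ennreal (G y powr s)"]
    have prod_H: "ennreal ((\<Prod>i<j. H (X i x)) powr s) = (\<Prod>i<j. ennreal (H (X i x) powr s))" for j x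
      using H0 by (simp add: prod_powr_distrib prod_ennreal)
    have "(\<integral>\<^sup>+x. ennreal ((\<Sum>i<n. \<bar>z (\<tau> 0) x i\<bar>) powr s) \<partial>M) < \<infinity>"
    proof (rule affine_recursion_moment_finite[where
          V = "\<lambda>m x. \<Sum>i<n. \<bar>z (\<tau> m) x i\<bar>" and W = "\<lambda>m x. N (column_mat n (z (\<tau> m) x))"
          and a = "\<lambda>m x. H (X m x)" and c = "\<lambda>m x. G (X m x)" and \<kappa> = \<kappa> and \<rho> = \<rho> and b = b])
      show "(\<lambda>x. \<Sum>i<n. \<bar>z (\<tau> m) x i\<bar>) \<in> borel_measurable M" for m
        unfolding z_def by (intro borel_measurable_sum borel_measurable_abs garch_state_measurable meas)
      show "distr M borel (\<lambda>x. \<Sum>i<n. \<bar>z (\<tau> m) x i\<bar>) = distr M borel (\<lambda>x. \<Sum>i<n. \<bar>z (\<tau> 0) x i\<bar>)" for m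
        unfolding z_def by (rule distr_garch_state_stationary[OF stat])
      show "(\<Sum>i<n. \<bar>z (\<tau> m) x i\<bar>) \<le> \<kappa> * N (column_mat n (z (\<tau> m) x))" for m x
        by (rule order_trans[OF K2(2)])
           (auto simp: \<kappa>_def intro!: mult_right_mono multiplicative_norm_nonneg[OF N])
      show "N (column_mat n (z (\<tau> m) x)) \<le> \<kappa> * (\<Sum>i<n. \<bar>z (\<tau> m) x i\<bar>)" for m x
        by (rule order_trans[OF K1(2)]) (auto simp: \<kappa>_def intro!: mult_right_mono sum_nonneg)
      show "0 \<le> \<kappa>" using K1 by (simp add: \<kappa>_def)
      show "(\<integral>\<^sup>+x. ennreal ((\<Prod>i<j. H (X i x)) powr s) \<partial>M) \<le> ennreal (\<rho> ^ j)" for j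
        unfolding prod_H using blocks(1)[of j] \<rho> by (simp add: ennreal_power)
      show "(\<integral>\<^sup>+x. ennreal (((\<Prod>i<j. H (X i x)) * G (X j x)) powr s) \<partial>M) \<le> ennreal (\<rho> ^ j * b)" for j
      proof -
        have "ennreal (((\<Prod>i<j. H (X i x)) * G (X j x)) powr s)
            = (\<Prod>i<j. ennreal (H (X i x) powr s)) * ennreal (G (X j x) powr s)" for x
          unfolding prod_H[symmetric] by (simp add: powr_mult ennreal_mult)
        then show ?thesis using blocks(2)[of j] \<rho> b by (simp add: ennreal_power ennreal_mult)
      qed
      show "AE x in M. \<forall>m. N (column_mat n (z (\<tau> m) x))
          \<le> H (X m x) * N (column_mat n (z (\<tau> (Suc m)) x)) + G (X m x)"
        using rec_z
      proof eventually_elim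
        case (elim x)
        show ?case
        proof
          fix m
          let ?a = "\<tau> (Suc m)"
          have "N (column_mat n (z (?a + int k) x))
              \<le> N (left_product n (\<lambda>u. C (\<eta> (?a + u) x)) k) * N (column_mat n (z ?a x))
                + L ^ k * (\<Sum>u=1..k. N (column_mat n (garch_shock q \<omega> (\<eta> (?a + int u) x))))"
            by (rule matrix_recursion_unfold[where C = "\<lambda>u. C (\<eta> u x)" and Z = "\<lambda>u. column_mat n (z u x)"
                  and B = "\<lambda>u. column_mat n (garch_shock q \<omega> (\<eta> u x))",
                  OF N C column_mat_carrier column_mat_carrier _ L(2,1)]) (rule elim[rule_format])
          also have "N (left_product n (\<lambda>u. C (\<eta> (?a + u) x)) k) = H (X m x)"
            using H_cong[of "\<lambda>u. \<eta> (?a + u) x"] unfolding X_def by (simp only: H_def)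
          also have "L ^ k * (\<Sum>u=1..k. N (column_mat n (garch_shock q \<omega> (\<eta> (?a + int u) x)))) \<le> G (X m x)"
          proof -
            have "N (column_mat n (garch_shock q \<omega> e)) \<le> K1 * (real n * (\<bar>\<omega>\<bar> + \<bar>ln (e\<^sup>2)\<bar>))" for e
              using K1 by (intro order_trans[OF K1(2)] mult_left_mono sum_abs_garch_shock_le)
            then have "(\<Sum>u=1..k. N (column_mat n (garch_shock q \<omega> (\<eta> (?a + int u) x))))
                \<le> (\<Sum>u=1..k. K1 * (real n * (\<bar>\<omega>\<bar> + \<bar>ln ((\<eta> (?a + int u) x)\<^sup>2)\<bar>)))"
              by (intro sum_mono)
            from mult_left_mono[OF this, of "L ^ k"] L
            have "L ^ k * (\<Sum>u=1..k. N (column_mat n (garch_shock q \<omega> (\<eta> (?a + int u) x))))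
                \<le> G (\<lambda>u. \<eta> (?a + u) x)"
              unfolding G_def by (simp add: sum_distrib_left mult.assoc)
            then show ?thesis
              using G_cong[of "\<lambda>u. \<eta> (?a + u) x"] unfolding X_def by simp
          qed
          finally show "N (column_mat n (z (\<tau> m) x))
              \<le> H (X m x) * N (column_mat n (z (\<tau> (Suc m)) x)) + G (X m x)"
            by (simp add: \<tau>_Suc[of m])
        qed
      qed
    qed (use s \<rho> b H0 G0 in \<open>auto intro: sum_nonneg\<close>)
    then show ?thesis by (simp add: \<tau>_def)
  qed
  then show ?thesis using s by (auto simp: n_def z_def)
qed

section \<open>From the state back to volatility and observations\<close>

theorem proposition2p1:
  fixes M :: "'a measure"
    and p q :: nat
    and \<omega> :: real
    and \<alpha>p \<alpha>m \<beta> :: "nat \<Rightarrow> real"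
    and \<eta> \<epsilon> \<sigma> :: "int \<Rightarrow> 'a \<Rightarrow> real"
    and N :: "real mat \<Rightarrow> real"
    and s0 :: real
  assumes "prob_space M"
    and "iid M \<eta>"
    and "integrable M (\<eta> 0)" and "(\<integral>x. \<eta> 0 x \<partial>M) = 0"
    and "integrable M (\<lambda>x. (\<eta> 0 x)\<^sup>2)" and "(\<integral>x. (\<eta> 0 x)\<^sup>2 \<partial>M) = 1"
    and "multiplicative_norm (2 * q + p) N"
    and "top_lyapunov M (2 * q + p) N (\<lambda>t x. garch_matrix p q \<alpha>p \<alpha>m \<beta> (\<eta> t x)) < 0"
    and "s0 > 0" and "abs_log_moment M s0 (\<lambda>x. (\<eta> 0 x)\<^sup>2) < \<infinity>"
    and "log_garch_solution M p q \<omega> \<alpha>p \<alpha>m \<beta> \<eta> \<epsilon> \<sigma>"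
    and "strictly_stationary M (borel \<Otimes>\<^sub>M borel) (\<lambda>t x. (\<epsilon> t x, \<sigma> t x))"
  shows "\<exists>s>0. \<forall>t. abs_log_moment M s (\<lambda>x. (\<epsilon> t x)\<^sup>2) < \<infinity> \<and>
                   abs_log_moment M s (\<lambda>x. (\<sigma> t x)\<^sup>2) < \<infinity>"
proof -
  interpret prob_space M by fact
  have [measurable]: "\<eta> t \<in> borel_measurable M" for t
    using \<open>iid M \<eta>\<close> by (auto simp: iid_def indep_vars_def)
  have [measurable]: "\<epsilon> t \<in> borel_measurable M" "\<sigma> t \<in> borel_measurable M" for t
    using \<open>log_garch_solution M p q \<omega> \<alpha>p \<alpha>m \<beta> \<eta> \<epsilon> \<sigma>\<close> by (auto simp: log_garch_solution_def)
  have law: "distr M borel (\<eta> t) = distr M borel (\<eta> 0)" for t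
    using \<open>iid M \<eta>\<close> by (auto simp: iid_def)
  \<comment> \<open>The moment is given at time 0 only; the common law carries it to every
    time.\<close>
  have "abs_log_moment M s0 (\<lambda>x. (\<eta> t x)\<^sup>2) < \<infinity>" for t
    using \<open>abs_log_moment M s0 (\<lambda>x. (\<eta> 0 x)\<^sup>2) < \<infinity>\<close>
      abs_log_moment_distr[of "\<eta> t" M s0] abs_log_moment_distr[of "\<eta> 0" M s0] law[of t]
    by simp
  then have "(AE x in M. 0 < (\<eta> t x)\<^sup>2) \<and> (\<integral>\<^sup>+x. ennreal (\<bar>ln ((\<eta> t x)\<^sup>2)\<bar> powr s0) \<partial>M) < \<infinity>" for t
    using abs_log_moment_finite_iff[of "\<lambda>x. (\<eta> t x)\<^sup>2" M s0] \<open>s0 > 0\<close> by simp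
  then have eta: "AE x in M. 0 < (\<eta> t x)\<^sup>2" "(\<integral>\<^sup>+x. ennreal (\<bar>ln ((\<eta> t x)\<^sup>2)\<bar> powr s0) \<partial>M) < \<infinity>" for t
    by blast+
  let ?z = "\<lambda>t x. garch_state q (\<lambda>u. \<epsilon> u x) (\<lambda>u. \<sigma> u x) t"
  let ?V = "\<lambda>t x. \<Sum>i<2 * q + p. \<bar>?z t x i\<bar>"
  have rec: "AE x in M. 0 < \<sigma> t x \<and> \<epsilon> t x = \<sigma> t x * \<eta> t x \<and>
       ln ((\<sigma> t x)\<^sup>2) = \<omega> + (\<Sum>j<2 * q + p. coeff_row q \<alpha>p \<alpha>m \<beta> j * ?z (t - 1) x j)" for t
    using \<open>log_garch_solution M p q \<omega> \<alpha>p \<alpha>m \<beta> \<eta> \<epsilon> \<sigma>\<close>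
    unfolding sum_coeff_row_garch_state log_garch_solution_def by (simp add: add.assoc)
  obtain s where s: "0 < s" "s \<le> 1" "s \<le> s0"
    and V: "\<And>t. (\<integral>\<^sup>+x. ennreal (?V t x powr s) \<partial>M) < \<infinity>"
    using garch_state_moment_finite[OF assms(2,7,8,9) eta(2) _ _ rec assms(12)] by auto
  have V_meas[measurable]: "?V t \<in> borel_measurable M" for t
    by (intro borel_measurable_sum borel_measurable_abs garch_state_measurable) measurable
  define K where "K = (\<Sum>j<2 * q + p. \<bar>coeff_row q \<alpha>p \<alpha>m \<beta> j\<bar>)"
  \<comment> \<open>The volatility is read off from the equation and the state at t - 1 rather than
    from an entry of the state at \<open>t\<close>, because for \<open>p = 0\<close> the state has
    no volatility entry.\<close>
  have sigma: "(\<integral>\<^sup>+x. ennreal (\<bar>ln ((\<sigma> t x)\<^sup>2)\<bar> powr s) \<partial>M) < \<infinity>" for t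
  proof -
    have "(\<integral>\<^sup>+x. ennreal (\<bar>ln ((\<sigma> t x)\<^sup>2)\<bar> powr s) \<partial>M)
        \<le> (\<integral>\<^sup>+x. ennreal ((\<bar>\<omega>\<bar> + K * ?V (t - 1) x) powr s) \<partial>M)"
    proof (rule nn_integral_mono_AE, use rec[of t] in eventually_elim)
      case (elim x)
      have "\<bar>\<Sum>j<2 * q + p. coeff_row q \<alpha>p \<alpha>m \<beta> j * ?z (t - 1) x j\<bar>
          \<le> (\<Sum>j<2 * q + p. \<bar>coeff_row q \<alpha>p \<alpha>m \<beta> j\<bar> * \<bar>?z (t - 1) x j\<bar>)"
        by (rule order_trans[OF sum_abs]) (simp add: abs_mult)
      also have "\<dots> \<le> (\<Sum>j<2 * q + p. K * \<bar>?z (t - 1) x j\<bar>)"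
        unfolding K_def by (intro sum_mono mult_right_mono member_le_sum) auto
      also have "\<dots> = K * ?V (t - 1) x" by (simp add: sum_distrib_left)
      finally have "\<bar>ln ((\<sigma> t x)\<^sup>2)\<bar> \<le> \<bar>\<omega>\<bar> + K * ?V (t - 1) x" using elim by linarith
      then show ?case using s by (intro ennreal_leI powr_mono2) auto
    qed
    also have "\<dots> < \<infinity>"
    proof (rule nn_integral_powr_add_finite)
      show "(\<integral>\<^sup>+x. ennreal ((K * ?V (t - 1) x) powr s) \<partial>M) < \<infinity>"
        using V_meas V by (rule nn_integral_powr_cmult_finite)
    qed (use s in \<open>auto simp: emeasure_space_1 K_def intro!: mult_nonneg_nonneg sum_nonneg\<close>)
    finally show ?thesis .
  qed
  \<comment> \<open>Almost surely the innovation is nonzero, so the logarithm of the product splits;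
    both summands have a finite moment of order \<open>s\<close>.\<close>
  have epsilon: "(\<integral>\<^sup>+x. ennreal (\<bar>ln ((\<epsilon> t x)\<^sup>2)\<bar> powr s) \<partial>M) < \<infinity>" for t
  proof -
    have "(\<integral>\<^sup>+x. ennreal (\<bar>ln ((\<epsilon> t x)\<^sup>2)\<bar> powr s) \<partial>M)
        \<le> (\<integral>\<^sup>+x. ennreal ((\<bar>ln ((\<sigma> t x)\<^sup>2)\<bar> + \<bar>ln ((\<eta> t x)\<^sup>2)\<bar>) powr s) \<partial>M)"
    proof (rule nn_integral_mono_AE, use rec[of t] eta(1)[of t] in eventually_elim)
      case (elim x)
      then have "ln ((\<epsilon> t x)\<^sup>2) = ln ((\<sigma> t x)\<^sup>2) + ln ((\<eta> t x)\<^sup>2)"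
        by (simp add: power_mult_distrib ln_mult_pos)
      then show ?case using s by (intro ennreal_leI powr_mono2) auto
    qed
    also have "\<dots> < \<infinity>"
    proof (rule nn_integral_powr_add_finite)
      show "(\<integral>\<^sup>+x. ennreal (\<bar>ln ((\<eta> t x)\<^sup>2)\<bar> powr s) \<partial>M) < \<infinity>"
        by (rule nn_integral_powr_exponent_mono[OF _ _ s(1,3) eta(2)]) auto
    qed (use s sigma in auto)
    finally show ?thesis .
  qed
  have sigma_pos: "AE x in M. 0 < (\<sigma> t x)\<^sup>2" for t
    using rec[of t] by eventually_elim simp
  have epsilon_pos: "AE x in M. 0 < (\<epsilon> t x)\<^sup>2" for t
    using rec[of t] eta(1)[of t] by eventually_elim simp
  show ?thesis
  proof (intro exI conjI allI)
    fix t
    show "abs_log_moment M s (\<lambda>x. (\<epsilon> t x)\<^sup>2) < \<infinity>"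
      by (subst abs_log_moment_finite_iff) (use s epsilon epsilon_pos in auto)
    show "abs_log_moment M s (\<lambda>x. (\<sigma> t x)\<^sup>2) < \<infinity>"
      by (subst abs_log_moment_finite_iff) (use s sigma sigma_pos in auto)
  qed (rule s)
qed

end
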